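(* Let $b,c>0$ and let $f$ be a continuous function on $\mathbb{R}_+=[0,\infty)$ such that, for some $\varepsilon>0$, $f(x)=o(x^{-b-1-\varepsilon})$ as $x\to+\infty$. Let $g(s)=[\widehat f(s)]_{b,c}$ be the index hypergeometric transform of $f$, considered as a holomorphic function in the strip $|\operatorname{Im}s|<1+\varepsilon$. Then the index hypergeometric transform of the function $x\mapsto xf(x)$ is $$[\widehat{xf(x)}]_{b,c}(s)=Pg(s),$$ where $P$ is the difference operator $$Pg(s)=\frac{(b-is)(c-is)}{(-2is)(1-2is)}\bigl(g(s+i)-g(s)\bigr)+\frac{(b+is)(c+is)}{(2is)(1+2is)}\bigl(g(s-i)-g(s)\bigr)$$ (for real $s$; the value at $s=0$ is understood by continuity).
   Context: For $b,c>0$ the index hypergeometric transform of a function $f$ on $\mathbb{R}_+$ is $$[\widehat f(s)]_{b,c}=J_{b,c}f(s)=\frac1{\Gamma(b+c)}\int_0^\infty f(x)\,{}_2F_1(b+is,b-is;b+c;-x)\,x^{b+c-1}(1+x)^{b-c}\,dx,$$ where ${}_2F_1$ is the Gauss hypergeometric function (analytically continued to $\mathbb{C}\setminus[1,\infty)$ in its last argument). Under the decay hypothesis on $f$ the integral converges and defines a holomorphic function of $s$ in the strip $|\operatorname{Im}s|<1+\varepsilon$; values such as $g(s\pm i)$ for real $s$ refer to this holomorphic function. *)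

theory Defs
  imports "HOL-Analysis.Analysis" "HOL-Library.Landau_Symbols"
begin

(* The analytic continuation of the Gauss series to the plane cut along [1, \<infinity>).  The cut plane
   is connected, so two choices of F agree at every point of it; the values on the cut itself are
   unspecified.  Meant for c not in {0, -1, -2, ...}. *)
definition hyp2F1 :: "complex \<Rightarrow> complex \<Rightarrow> complex \<Rightarrow> complex \<Rightarrow> complex" where
  "hyp2F1 a b c = (SOME F. F holomorphic_on (UNIV - of_real ` {1..}) \<and>
     (\<forall>z\<in>ball 0 1. F z = eval_fps (fps_hypergeo [a, b] [c] 1) z))"

definition index_integrand ::
    "real \<Rightarrow> real \<Rightarrow> (real \<Rightarrow> complex) \<Rightarrow> complex \<Rightarrow> real \<Rightarrow> complex" where
  "index_integrand b c f s x =
     f x * hyp2F1 (of_real b + \<i> * s) (of_real b - \<i> * s) (of_real (b + c)) (- of_real x)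
         * of_real (x powr (b + c - 1)) * of_real ((1 + x) powr (b - c))"

definition index_transform ::
    "real \<Rightarrow> real \<Rightarrow> (real \<Rightarrow> complex) \<Rightarrow> complex \<Rightarrow> complex" where
  "index_transform b c f s =
     1 / of_real (Gamma (b + c)) * (LINT x:{0..}|lborel. index_integrand b c f s x)"

(* At s = 0 the denominators vanish; there the value has to be taken as a limit. *)
definition difference_op ::
    "real \<Rightarrow> real \<Rightarrow> (complex \<Rightarrow> complex) \<Rightarrow> complex \<Rightarrow> complex" where
  "difference_op b c g s =
     (of_real b - \<i> * s) * (of_real c - \<i> * s) / ((- 2 * \<i> * s) * (1 - 2 * \<i> * s))
       * (g (s + \<i>) - g s)
   + (of_real b + \<i> * s) * (of_real c + \<i> * s) / ((2 * \<i> * s) * (1 + 2 * \<i> * s))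
       * (g (s - \<i>) - g s)"

end

theory Submission
  imports Defs "HOL-Complex_Analysis.Complex_Analysis"
begin

unbundle no vec_syntax

text \<open>
  Comparing Taylor coefficients at the origin and continuing analytically, one finds that
  $F(s,x) = {}_2F_1(b+is, b-is; b+c; -x)$ satisfies $x F(s,x) = (P F(\cdot,x))(s)$ for every
  $x$; integrating this contiguous relation against $f$ gives the theorem.  The integrals converge,
  and depend holomorphically on $s$, because $F(s,x) = O(x^{-b+|\mathrm{Im}\, s|+\delta})$
  locally uniformly in $s$.  To see this, take $\mathrm{Im}\, s \ge 0$ (as $F$ is even in $s$)
  and apply the Pfaff transformation
  $F(s,x) = (1+x)^{-b-is} {}_2F_1(b+is, c+is; b+c; x/(1+x))$: the coefficients of the series on the
  right are dominated by those of $(1-y)^{-\delta}$.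
\<close>

subsection \<open>The Gauss series\<close>

text \<open>\<open>hyp2F1\<close> is a chosen function, so nothing can be said of it until some
  continuation to the whole cut plane is exhibited. The Pfaff formula alone cannot do this: its
  series in z/(z-1) converges only for Re z < 1/2. The substitution z = 4w/(1+w)^2 reaches the whole
  cut plane at once. The hypergeometric equation pulls back to one whose finite singular points are
  0, 1 and -1, so its power series solution at w = 0 converges in the unit disc. The choice is made
  separately for each pair of parameters and so carries no regularity in s by itself; the dependence
  on s is read off the Pfaff series instead. The unit in the decay exponent b + 1 + \<epsilon> pays
  for the shifts to s + i and s - i, each of which costs one power of x, just as the factor x does.
  The estimates are therefore stated for a general exponent b + \<kappa> and used twice, with
  \<kappa> = 1 + \<epsilon> for f and \<kappa> = \<epsilon> for x f(x).\<close>

lemma fps_hypergeo_2_1_nth: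
  "fps_hypergeo [a, b] [c] 1 $ n = pochhammer a n * pochhammer b n / (pochhammer c n * fact n)"
  by simp

lemma pochhammer_of_real_nonzero:
  fixes c :: real
  assumes "c > 0"
  shows "pochhammer (of_real c :: complex) n \<noteq> 0"
  using pochhammer_pos[OF assms, of n] by (simp add: pochhammer_of_real)

lemma of_real_add_of_nat_nonzero: "c > 0 \<Longrightarrow> complex_of_real c + of_nat n \<noteq> 0"
  by (metis add_pos_nonneg less_irrefl of_nat_0_le_iff of_real_add of_real_eq_0_iff of_real_of_nat_eq)

text \<open>AM-GM is applied to the product as a whole so that only \<open>Re (a + b)\<close> enters
  the linear term. Bounding the two factors separately would put \<open>norm a + norm b\<close>
  there and spoil the exponent of the growth estimate.\<close>

lemma norm_add_nat_mult_le:
  fixes a b :: complex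
  assumes "norm a \<le> R" "norm b \<le> R" "Re (a + b) \<le> \<sigma>"
  shows "norm (a + of_nat n) * norm (b + of_nat n) \<le> real n ^ 2 + real n * \<sigma> + R ^ 2"
proof -
  have sq: "norm (w + of_nat n) ^ 2 = real n ^ 2 + 2 * real n * Re w + norm w ^ 2" for w :: complex
    unfolding cmod_power2 by (simp add: power2_eq_square algebra_simps)
  have "norm (a + of_nat n) * norm (b + of_nat n) \<le> (norm (a + of_nat n) ^ 2 + norm (b + of_nat n) ^ 2) / 2"
    using sum_squares_bound[of "norm (a + of_nat n)" "norm (b + of_nat n)"] by simp
  also have "\<dots> = real n ^ 2 + real n * Re (a + b) + (norm a ^ 2 + norm b ^ 2) / 2"
    by (simp only: sq) (simp add: field_simps)
  also have "\<dots> \<le> real n ^ 2 + real n * \<sigma> + R ^ 2"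
  proof -
    have "norm a ^ 2 \<le> R ^ 2" "norm b ^ 2 \<le> R ^ 2"
      using assms by (auto intro!: power_mono)
    moreover have "real n * Re (a + b) \<le> real n * \<sigma>"
      using assms by (intro mult_left_mono) auto
    ultimately show ?thesis by (intro add_mono) (auto simp: field_simps)
  qed
  finally show ?thesis .
qed

text \<open>By AM-GM, $|a+n||b+n|$ is at most $n^2 + \sigma n + R^2$, which drops below
  $(c+n)(\delta+n)$ as soon as $n(c+\delta-\sigma)$ exceeds $R^2$.\<close>
lemma norm_pochhammer_mult_le:
  fixes a b :: complex and c \<delta> :: real
  assumes "c > 0" "\<delta> > 0" "norm a \<le> R" "norm b \<le> R" "Re (a + b) \<le> \<sigma>" "\<sigma> < c + \<delta>"
    and N: "R ^ 2 \<le> real N * (c + \<delta> - \<sigma>)"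
  shows "norm (pochhammer a n * pochhammer b n)
    \<le> (1 + R ^ 2 / (c * \<delta>)) ^ N * (pochhammer c n * pochhammer \<delta> n)"
proof -
  \<comment> \<open>For \<open>n < N\<close> the excess \<open>R ^ 2\<close> is absorbed by the
    factor \<open>Q\<close>, because \<open>(c + n) * (\<delta> + n)\<close> is at least
    \<open>c * \<delta>\<close>.\<close>
  define Q where "Q = 1 + R ^ 2 / (c * \<delta>)"
  have Q: "Q \<ge> 1" using assms by (simp add: Q_def)
  have pos: "pochhammer c n > 0" "pochhammer \<delta> n > 0" for n
    using assms by (auto intro: pochhammer_pos)
  have step: "norm (a + of_nat n) * norm (b + of_nat n)
      \<le> (if n < N then Q else 1) * ((c + n) * (\<delta> + n))" for n
  proof -
    have "norm (a + of_nat n) * norm (b + of_nat n) \<le> real n ^ 2 + real n * \<sigma> + R ^ 2"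
      by (rule norm_add_nat_mult_le) fact+
    also have "\<dots> \<le> (if n < N then Q else 1) * ((c + n) * (\<delta> + n))"
    proof (cases "n < N")
      case True
      have "real n * \<sigma> \<le> real n * (c + \<delta>)"
        using assms by (intro mult_left_mono) auto
      hence "real n ^ 2 + real n * \<sigma> + R ^ 2 \<le> (c + n) * (\<delta> + n) + R ^ 2 * 1"
        using mult_pos_pos[OF \<open>c > 0\<close> \<open>\<delta> > 0\<close>] by (simp add: algebra_simps power2_eq_square)
      also have "R ^ 2 * 1 \<le> R ^ 2 * ((c + n) * (\<delta> + n) / (c * \<delta>))"
        using assms by (intro mult_left_mono) (auto simp: field_simps)
      also have "(c + n) * (\<delta> + n) + \<dots> = Q * ((c + n) * (\<delta> + n))"
        by (simp add: Q_def field_simps)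
      finally show ?thesis using True by simp
    next
      case False
      hence "R ^ 2 \<le> real n * (c + \<delta> - \<sigma>)"
        using assms by (intro order.trans[OF N] mult_right_mono) auto
      thus ?thesis using False mult_pos_pos[OF \<open>c > 0\<close> \<open>\<delta> > 0\<close>]
        by (simp add: algebra_simps power2_eq_square)
    qed
    finally show ?thesis .
  qed
  \<comment> \<open>The exponent counts the indices below \<open>N\<close> met so far, which makes
    the induction close; afterwards it stays at \<open>N\<close>.\<close>
  have "norm (pochhammer a n * pochhammer b n) \<le> Q ^ min n N * (pochhammer c n * pochhammer \<delta> n)"
  proof (induction n)
    case (Suc n)
    have "norm (pochhammer a (Suc n) * pochhammer b (Suc n))
        = norm (pochhammer a n * pochhammer b n) * (norm (a + of_nat n) * norm (b + of_nat n))"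
      by (simp add: pochhammer_Suc norm_mult)
    also have "\<dots> \<le> (Q ^ min n N * (pochhammer c n * pochhammer \<delta> n)) *
        ((if n < N then Q else 1) * ((c + n) * (\<delta> + n)))"
      using pos[of n] Q by (intro mult_mono Suc.IH step) auto
    also have "\<dots> = Q ^ min (Suc n) N * (pochhammer c (Suc n) * pochhammer \<delta> (Suc n))"
    proof -
      have "Q ^ min (Suc n) N = Q ^ min n N * (if n < N then Q else 1)"
        by (cases "n < N") (auto simp: min_absorb1 min_absorb2)
      thus ?thesis by (simp add: pochhammer_Suc)
    qed
    finally show ?case .
  qed auto
  also have "\<dots> \<le> Q ^ N * (pochhammer c n * pochhammer \<delta> n)"
    using pos[of n] Q by (intro mult_right_mono power_increasing) auto
  finally show ?thesis by (simp add: Q_def)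
qed

text \<open>\<open>C\<close> is fixed before \<open>a\<close> and \<open>b\<close>. This uniformity
  makes the later growth estimate locally uniform in s and supplies the Weierstrass majorant for
  holomorphy in the parameters.\<close>

lemma fps_hypergeo_nth_bound:
  fixes c \<delta> \<sigma> R :: real
  assumes "c > 0" "\<delta> > 0" "\<sigma> < c + \<delta>"
  obtains C where "C \<ge> 0"
    "\<And>a b n. norm a \<le> R \<Longrightarrow> norm b \<le> R \<Longrightarrow> Re (a + b) \<le> \<sigma> \<Longrightarrow>
       norm (fps_hypergeo [a, b] [of_real c] 1 $ n) \<le> C * (pochhammer \<delta> n / fact n)"
proof -
  obtain N :: nat where "real N > R ^ 2 / (c + \<delta> - \<sigma>)"
    using reals_Archimedean2 by blast
  hence N: "R ^ 2 \<le> real N * (c + \<delta> - \<sigma>)"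
    using assms by (simp add: field_simps)
  show ?thesis
  proof (rule that)
    show "(1 + R ^ 2 / (c * \<delta>)) ^ N \<ge> 0" using assms by simp
    fix a b :: complex and n
    assume "norm a \<le> R" "norm b \<le> R" "Re (a + b) \<le> \<sigma>"
    note bnd = norm_pochhammer_mult_le[OF assms(1,2) this assms(3) N, of n]
    have "pochhammer c n > 0" using assms by (intro pochhammer_pos)
    moreover have "norm (fps_hypergeo [a, b] [of_real c] 1 $ n) =
        norm (pochhammer a n * pochhammer b n) / (pochhammer c n * fact n)"
      using \<open>pochhammer c n > 0\<close>
      by (simp add: fps_hypergeo_2_1_nth norm_mult norm_divide pochhammer_of_real)
    moreover have "u / (p * q) \<le> X * (v / q)" if "u \<le> X * (p * v)" "p > 0" "q > 0" for u v p q X :: real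
      using that by (simp add: field_simps)
    ultimately show "norm (fps_hypergeo [a, b] [of_real c] 1 $ n)
        \<le> (1 + R ^ 2 / (c * \<delta>)) ^ N * (pochhammer \<delta> n / fact n)"
      using bnd by (simp del: fps_hypergeo_nth)
  qed
qed

lemma pochhammer_sums:
  fixes r \<delta> :: real
  assumes "\<bar>r\<bar> < 1"
  shows "(\<lambda>n. pochhammer \<delta> n / fact n * r ^ n) sums (1 - r) powr (-\<delta>)"
proof -
  have "(\<lambda>n. (-\<delta> gchoose n) * (-r) ^ n) sums (1 + (-r)) powr (-\<delta>)"
    using assms by (intro gen_binomial_real) auto
  also have "(\<lambda>n. (-\<delta> gchoose n) * (-r) ^ n) = (\<lambda>n. pochhammer \<delta> n / fact n * r ^ n)"
    by (simp add: gbinomial_pochhammer fun_eq_iff flip: power_mult_distrib)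
  finally show ?thesis by simp
qed

text \<open>Only an inequality is possible: for \<open>a\<close> or \<open>b\<close> in {0, -1, -2,
  ...} the series is a polynomial. The value of \<delta> is just large enough for the coefficient
  bound; the majorizing binomial series converges for every r < 1 whatever \<delta> is.\<close>

lemma fps_conv_radius_hypergeo:
  fixes c :: real
  assumes "c > 0"
  shows "fps_conv_radius (fps_hypergeo [a, b] [of_real c :: complex] 1) \<ge> 1"
proof -
  define R \<delta> where "R = max (norm a) (norm b)" and "\<delta> = \<bar>Re (a + b)\<bar> + 1"
  have \<delta>: "\<delta> > 0" "Re (a + b) < c + \<delta>" using assms by (auto simp: \<delta>_def)
  obtain C where C: "\<And>a' b' n. norm a' \<le> R \<Longrightarrow> norm b' \<le> R \<Longrightarrow> Re (a' + b') \<le> Re (a + b) \<Longrightarrow>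
      norm (fps_hypergeo [a', b'] [of_real c] 1 $ n) \<le> C * (pochhammer \<delta> n / fact n)"
    using fps_hypergeo_nth_bound[OF assms \<delta>, of R] by metis
  have C: "norm (fps_hypergeo [a, b] [of_real c] 1 $ n) \<le> C * (pochhammer \<delta> n / fact n)" for n
    by (rule C) (auto simp: R_def)
  show ?thesis unfolding fps_conv_radius_def
  proof (rule conv_radius_geI_ex)
    fix r :: real assume r: "0 < r" "ereal r < 1"
    have "summable (\<lambda>n. C * (pochhammer \<delta> n / fact n * r ^ n))"
      using r by (intro summable_mult sums_summable[OF pochhammer_sums]) auto
    hence "summable (\<lambda>n. fps_hypergeo [a, b] [of_real c] 1 $ n * of_real r ^ n)"
    proof (rule summable_comparison_test[rotated], intro exI[of _ 0] allI impI)
      fix n :: nat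
      show "norm (fps_hypergeo [a, b] [of_real c] 1 $ n * of_real r ^ n)
          \<le> C * (pochhammer \<delta> n / fact n * r ^ n)"
        using mult_right_mono[OF C[of n], of "r ^ n"] r
        by (simp add: norm_mult norm_power mult_ac del: fps_hypergeo_nth)
    qed
    thus "\<exists>z::complex. norm z = r \<and> summable (\<lambda>n. fps_hypergeo [a, b] [of_real c] 1 $ n * z ^ n)"
      using r by (intro exI[of _ "of_real r"]) auto
  qed
qed

text \<open>This is the convergence argument for a power series solution at a regular singular
  point. If \<open>norm (g $ k) * r ^ k\<close> is at most \<open>M\<close> for all k up to m, the
  right-hand side scaled by \<open>r ^ m\<close> is at most
  \<open>(m + 1) * K * M / (1 - r) ^ 2\<close>, since the weights j + 1 sum to 1/(1-r)^2 against
  r^j. The left factor \<open>(m + 1) * (m + c)\<close> beats this for large m, so the same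
  \<open>M\<close> serves for m + 1.\<close>

lemma fps_conv_radius_ge_1_of_recurrence:
  fixes g :: "complex fps" and c K :: real
  assumes "c > 0" and K: "K \<ge> 0"
    and rec: "\<And>n. real (n + 1) * (real n + c) * norm (g $ (n + 1))
       \<le> K * (\<Sum>k\<le>n. real (k + 1) * real (n - k + 1) * norm (g $ k))"
  shows "fps_conv_radius g \<ge> 1"
proof -
  have bdd: "\<exists>M. \<forall>n. norm (g $ n) * r ^ n \<le> M" if r: "0 < r" "r < 1" for r :: real
  proof -
    \<comment> \<open>Beyond this index \<open>m + c\<close> exceeds \<open>K / (1 - r) ^ 2\<close>,
      so the bound no longer grows; \<open>M\<close> only has to dominate the finitely many terms up
      to \<open>N\<close>.\<close>
    obtain N :: nat where N: "real N > K / (1 - r) ^ 2" using reals_Archimedean2 by blast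
    define M where "M = (\<Sum>k\<le>N. norm (g $ k) * r ^ k)"
    have M0: "M \<ge> 0" using r unfolding M_def by (intro sum_nonneg) auto
    have "norm (g $ n) * r ^ n \<le> M" for n
    proof (induction n rule: less_induct)
      case (less n)
      show ?case
      proof (cases "n \<le> N")
        case True
        thus ?thesis unfolding M_def using r by (intro member_le_sum) auto
      next
        case False
        then obtain m where m: "n = Suc m" "m \<ge> N" by (cases n) auto
        have geo: "(\<Sum>k\<le>m. real (m - k + 1) * r ^ (m - k)) \<le> 1 / (1 - r) ^ 2"
        proof -
          have "(\<Sum>k\<le>m. real (m - k + 1) * r ^ (m - k)) = (\<Sum>k\<le>m. real (Suc k) * r ^ k)"
            using sum.nat_diff_reindex[of "\<lambda>k. real (Suc k) * r ^ k" "Suc m"]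
            by (simp add: lessThan_Suc_atMost)
          also have "\<dots> \<le> (\<Sum>k. real (Suc k) * r ^ k)"
            using r by (intro sum_le_suminf sums_summable[OF geometric_deriv_sums]) auto
          also have "\<dots> = 1 / (1 - r) ^ 2"
            using geometric_deriv_sums[of r] r by (simp add: sums_iff)
          finally show ?thesis .
        qed
        have "real (m + 1) * (real m + c) * (norm (g $ n) * r ^ n)
            = r * (r ^ m * (real (m + 1) * (real m + c) * norm (g $ (m + 1))))"
          by (simp add: m)
        also have "\<dots> \<le> 1 * (r ^ m * (K * (\<Sum>k\<le>m. real (k + 1) * real (m - k + 1) * norm (g $ k))))"
          using r K \<open>c > 0\<close>
          by (intro mult_mono[OF _ mult_left_mono[OF rec]] mult_nonneg_nonneg sum_nonneg) auto
        also have "\<dots> = K * (\<Sum>k\<le>m. real (k + 1) * (real (m - k + 1) * r ^ (m - k)) * (norm (g $ k) * r ^ k))"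
          unfolding sum_distrib_left mult_1_left
        proof (rule sum.cong[OF refl])
          fix k assume "k \<in> {..m}"
          hence "r ^ m = r ^ (m - k) * r ^ k" by (simp flip: power_add)
          thus "r ^ m * (K * (real (k + 1) * real (m - k + 1) * norm (g $ k))) =
            K * (real (k + 1) * (real (m - k + 1) * r ^ (m - k)) * (norm (g $ k) * r ^ k))"
            by (simp add: mult_ac)
        qed
        also have "\<dots> \<le> K * (\<Sum>k\<le>m. real (m + 1) * (real (m - k + 1) * r ^ (m - k)) * M)"
          using r K m less.IH by (intro mult_left_mono sum_mono mult_mono) auto
        also have "\<dots> = real (m + 1) * (K * (\<Sum>k\<le>m. real (m - k + 1) * r ^ (m - k)) * M)"
          by (simp add: sum_distrib_left sum_distrib_right mult_ac)
        also have "\<dots> \<le> real (m + 1) * (K * (1 / (1 - r) ^ 2) * M)"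
          using K M0 by (intro mult_left_mono mult_right_mono geo) auto
        also have "\<dots> \<le> real (m + 1) * ((real m + c) * M)"
          using N m M0 \<open>c > 0\<close> by (intro mult_left_mono mult_right_mono) auto
        finally have "(real (m + 1) * (real m + c)) * (norm (g $ n) * r ^ n) \<le> (real (m + 1) * (real m + c)) * M"
          by (simp add: mult_ac)
        thus ?thesis using \<open>c > 0\<close> by (subst (asm) mult_le_cancel_left_pos) auto
      qed
    qed
    thus ?thesis by blast
  qed
  show ?thesis unfolding fps_conv_radius_def
  proof (rule conv_radius_geI_ex)
    fix r :: real assume r: "0 < r" "ereal r < 1"
    \<comment> \<open>Boundedness at a radius strictly between r and 1 gives summability at r, by
      comparison with a geometric series of ratio r/q.\<close>
    define q where "q = (r + 1) / 2"
    have q: "r < q" "0 < q" "q < 1" using r by (auto simp: q_def)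
    obtain M where M: "norm (g $ n) * q ^ n \<le> M" for n using bdd[of q] q by blast
    have "summable (\<lambda>n. M * (r / q) ^ n)"
      using q r by (intro summable_mult summable_geometric) auto
    hence "summable (\<lambda>n. g $ n * of_real r ^ n)"
    proof (rule summable_comparison_test[rotated], intro exI[of _ 0] allI impI)
      fix n :: nat
      show "norm (g $ n * of_real r ^ n) \<le> M * (r / q) ^ n"
        using mult_right_mono[OF M[of n], of "(r / q) ^ n"] q r
        by (simp add: norm_mult norm_power power_divide)
    qed
    thus "\<exists>z::complex. norm z = r \<and> summable (\<lambda>n. g $ n * z ^ n)"
      using r by (intro exI[of _ "of_real r"]) auto
  qed
qed

subsection \<open>Continuation to the cut plane\<close>

text \<open>Taking the coefficient of X^n turns the equation into the two-term recurrence between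
  consecutive hypergeometric coefficients.\<close>

lemma fps_hypergeo_ODE:
  fixes a b c :: complex
  assumes c: "\<And>n. c + of_nat n \<noteq> 0"
  defines "F \<equiv> fps_hypergeo [a, b] [c] 1"
  shows "fps_X * (1 - fps_X) * fps_deriv (fps_deriv F)
    + (fps_const c - fps_const (a + b + 1) * fps_X) * fps_deriv F - fps_const (a * b) * F = 0"
proof (rule fps_ext)
  fix n :: nat
  have rec: "of_nat (Suc n) * (c + of_nat n) * F $ Suc n = (a + of_nat n) * (b + of_nat n) * F $ n"
  proof -
    have "F $ Suc n = (a + of_nat n) * (b + of_nat n) / (of_nat (Suc n) * (c + of_nat n)) * F $ n"
      unfolding F_def by (subst fps_hypergeo_rec) (simp del: fps_hypergeo_nth)
    thus ?thesis using c[of n] by (simp del: of_nat_Suc)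
  qed
  have X2: "fps_X * (1 - fps_X) * fps_deriv (fps_deriv F)
    = fps_X * (fps_deriv (fps_deriv F) - fps_X * fps_deriv (fps_deriv F))" by (simp add: algebra_simps)
  show "(fps_X * (1 - fps_X) * fps_deriv (fps_deriv F)
    + (fps_const c - fps_const (a + b + 1) * fps_X) * fps_deriv F - fps_const (a * b) * F) $ n = 0 $ n"
    unfolding X2 using rec
    by (cases n; cases "n - 1") (auto simp: algebra_simps)
qed

text \<open>The hypergeometric equation pulled back along \<Phi> = 4X/(1+X)^2, with \<open>J\<close>
  and \<open>I\<close> standing for 1/(1+X) and 1/(1-X). It is arranged so that the n-th coefficient
  on the left is \<open>(n + 1) * (n + c) * G $ (n + 1)\<close>, while the right-hand side involves
  only \<open>G $ 0\<close>, ..., \<open>G $ n\<close>. The inverses enter through polynomial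
  relations, so the identities become ideal membership problems.\<close>

lemma fps_hypergeo_quadratic_ODE:
  fixes a b c :: complex
  assumes c: "\<And>n. c + of_nat n \<noteq> 0" and J: "(1 + fps_X) * J = 1" and I: "(1 - fps_X) * I = 1"
  defines "\<Phi> \<equiv> 4 * fps_X * J ^ 2"
  defines "G \<equiv> fps_hypergeo [a, b] [c] 1 oo \<Phi>"
  defines "A \<equiv> (fps_const (2 * c - 4 * a - 4 * b) + fps_const (2 * c - 2) * fps_X) * I * J"
  shows "fps_X * fps_deriv (fps_deriv G) + fps_const c * fps_deriv G
    = 4 * fps_const (a * b) * J ^ 2 * G - A * (fps_X * fps_deriv G)"
proof -
  define F where "F = fps_hypergeo [a, b] [c] 1"
  define P Q where "P = fps_deriv F oo \<Phi>" and "Q = fps_deriv (fps_deriv F) oo \<Phi>"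
  have [simp]: "\<Phi> $ 0 = 0" by (simp add: \<Phi>_def mult.assoc)
  have dJ: "fps_deriv J = - (J ^ 2)"
  proof -
    have "fps_deriv ((1 + fps_X) * J) = 0" by (simp only: J) simp
    hence "J + (1 + fps_X) * fps_deriv J = 0" by (simp add: algebra_simps)
    hence "J * J + ((1 + fps_X) * J) * fps_deriv J = 0" by algebra
    thus ?thesis using J by (simp add: power2_eq_square eq_neg_iff_add_eq_0 add.commute)
  qed
  have d\<Phi>: "fps_deriv \<Phi> = 4 * J ^ 2 - 8 * fps_X * J ^ 3"
    by (simp add: \<Phi>_def dJ fps_deriv_power algebra_simps power2_eq_square power3_eq_cube)
  have dd\<Phi>: "fps_deriv (fps_deriv \<Phi>) = 24 * fps_X * J ^ 4 - 16 * J ^ 3"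
    unfolding d\<Phi> by (simp add: dJ fps_deriv_power algebra_simps power2_eq_square power3_eq_cube power4_eq_xxxx)
  have dG: "fps_deriv G = P * fps_deriv \<Phi>"
    unfolding G_def P_def F_def by (rule fps_compose_deriv) simp
  have "fps_deriv P = Q * fps_deriv \<Phi>"
    unfolding P_def Q_def by (rule fps_compose_deriv) simp
  hence ddG: "fps_deriv (fps_deriv G) = Q * fps_deriv \<Phi> ^ 2 + P * fps_deriv (fps_deriv \<Phi>)"
    by (simp add: dG power2_eq_square algebra_simps)
  have "(fps_X * (1 - fps_X) * fps_deriv (fps_deriv F)
    + (fps_const c - fps_const (a + b + 1) * fps_X) * fps_deriv F - fps_const (a * b) * F) oo \<Phi> = 0"
    unfolding F_def by (subst fps_hypergeo_ODE[OF c]) simp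
  hence ODE: "fps_const (a * b) * G = \<Phi> * (1 - \<Phi>) * Q + (fps_const c - fps_const (a + b + 1) * \<Phi>) * P"
    by (simp add: fps_compose_add_distrib fps_compose_sub_distrib fps_compose_mult_distrib
        G_def P_def Q_def F_def del: fps_const_add fps_const_mult)
  \<comment> \<open>The pulled-back equation is 4 J^2 times the original one at \<Phi>. This
    identity matches the coefficients of F'', the next one those of F'; the latter is what
    determines \<open>A\<close>.\<close>
  have 1: "fps_X * fps_deriv \<Phi> ^ 2 = 4 * J ^ 2 * (\<Phi> * (1 - \<Phi>))"
    unfolding d\<Phi> unfolding \<Phi>_def using J by algebra
  have 2: "fps_X * fps_deriv (fps_deriv \<Phi>) + (fps_const c + fps_X * A) * fps_deriv \<Phi>
      = 4 * J ^ 2 * (fps_const c - fps_const (a + b + 1) * \<Phi>)"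
  proof -
    \<comment> \<open>The zero of the derivative at w = 1 cancels the factor \<open>I\<close> of
      \<open>A\<close>.\<close>
    have "fps_deriv \<Phi> = 4 * (1 - fps_X) * J ^ 3"
      unfolding d\<Phi> using J by algebra
    hence "A * fps_deriv \<Phi> = 4 * (fps_const (2 * c - 4 * a - 4 * b) + fps_const (2 * c - 2) * fps_X) * J ^ 4"
      unfolding A_def using I by algebra
    moreover have "fps_const (2 * c - 4 * a - 4 * b) = 2 * fps_const c - 4 * fps_const a - 4 * fps_const b"
      "fps_const (2 * c - 2) = 2 * fps_const c - 2" "fps_const (a + b + 1) = fps_const a + fps_const b + 1"
      by (simp_all add: fps_eq_iff fps_numeral_nth)
    ultimately show ?thesis
      unfolding dd\<Phi> unfolding d\<Phi> unfolding \<Phi>_def using J by algebra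
  qed
  show ?thesis unfolding ddG unfolding dG
    using 1 2 ODE by algebra
qed

text \<open>The coefficients of 1/(1-X) and 1/(1+X) have modulus 1, so those of \<open>J ^ 2\<close>
  and \<open>A\<close> grow at most linearly. The pulled-back equation then becomes a recurrence of
  the kind treated above.\<close>

lemma fps_conv_radius_hypergeo_quadratic:
  fixes a b :: complex and c :: real and J :: "complex fps"
  assumes "c > 0" and J: "(1 + fps_X) * J = 1"
  shows "fps_conv_radius (fps_hypergeo [a, b] [of_real c] 1 oo (4 * fps_X * J ^ 2)) \<ge> 1"
proof -
  define I :: "complex fps" where "I = Abs_fps (\<lambda>_. 1)"
  define A where "A = (fps_const (2 * of_real c - 4 * a - 4 * b) + fps_const (2 * of_real c - 2) * fps_X) * I * J"
  define G where "G = fps_hypergeo [a, b] [of_real c] 1 oo (4 * fps_X * J ^ 2)"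
  have I: "(1 - fps_X) * I = 1"
    by (rule fps_ext) (auto simp: I_def algebra_simps)
  have J_nth: "J = Abs_fps (\<lambda>n. (-1) ^ n)"
  proof -
    have "(1 + fps_X) * Abs_fps (\<lambda>n. (-1) ^ n :: complex) = 1"
    proof (rule fps_ext)
      fix n show "((1 + fps_X) * Abs_fps (\<lambda>n. (-1) ^ n :: complex)) $ n = 1 $ n"
        by (cases n) (auto simp: algebra_simps)
    qed
    with J have "(1 + fps_X) * J = (1 + fps_X) * Abs_fps (\<lambda>n. (-1) ^ n)" by simp
    moreover have "1 + fps_X \<noteq> (0 :: complex fps)"
      using J by auto
    ultimately show ?thesis by simp
  qed
  have mult_bound: "norm ((f * g) $ n) \<le> real (n + 1)"
    if "\<And>n. norm (f $ n) \<le> 1" "\<And>n. norm (g $ n) \<le> 1" for f g :: "complex fps" and n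
  proof -
    have "norm ((f * g) $ n) \<le> (\<Sum>i=0..n. norm (f $ i * g $ (n - i)))"
      unfolding fps_mult_nth by (rule norm_sum)
    also have "\<dots> \<le> (\<Sum>i=0..n. 1)"
      using that by (intro sum_mono) (auto simp: norm_mult intro!: mult_le_one)
    finally show ?thesis by simp
  qed
  have J2: "norm ((J ^ 2) $ n) \<le> real (n + 1)" for n
    unfolding power2_eq_square by (rule mult_bound) (simp_all add: J_nth norm_power)
  define k1 k2 where "k1 = norm (2 * of_real c - 4 * a - 4 * b)" and "k2 = norm (2 * of_real c - 2 :: complex)"
  have A: "norm (A $ n) \<le> (k1 + k2) * real (n + 1)" for n
  proof -
    have IJ: "norm ((I * J) $ n) \<le> real (n + 1)" for n
      by (rule mult_bound) (simp_all add: J_nth I_def norm_power)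
    have "A = fps_const (2 * of_real c - 4 * a - 4 * b) * (I * J) + fps_const (2 * of_real c - 2) * (fps_X * (I * J))"
      by (simp add: A_def algebra_simps)
    hence "norm (A $ n) \<le> k1 * norm ((I * J) $ n) + k2 * norm ((fps_X * (I * J)) $ n)"
      by (auto simp: k1_def k2_def norm_mult intro!: order.trans[OF norm_triangle_ineq])
    also have "\<dots> \<le> k1 * real (n + 1) + k2 * real (n + 1)"
      using IJ[of n] IJ[of "n - 1"]
      by (intro add_mono mult_left_mono) (auto simp: k1_def k2_def split: if_splits)
    finally show ?thesis by (simp add: algebra_simps)
  qed
  have eq: "fps_X * fps_deriv (fps_deriv G) + fps_const (of_real c) * fps_deriv G
    = 4 * fps_const (a * b) * J ^ 2 * G - A * (fps_X * fps_deriv G)"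
    unfolding G_def A_def by (rule fps_hypergeo_quadratic_ODE[OF of_real_add_of_nat_nonzero[OF \<open>c > 0\<close>] J I])
  \<comment> \<open>The first summand comes from the term with \<open>J ^ 2 * G\<close>, the second
    from the term with \<open>A\<close>.\<close>
  define K where "K = 4 * norm (a * b) + (k1 + k2)"
  have "K \<ge> 0" by (simp add: K_def k1_def k2_def)
  moreover have "real (n + 1) * (real n + c) * norm (G $ (n + 1))
       \<le> K * (\<Sum>k\<le>n. real (k + 1) * real (n - k + 1) * norm (G $ k))" for n
  proof -
    have "of_nat (n + 1) * (of_nat n + of_real c) * G $ (n + 1)
        = (fps_X * fps_deriv (fps_deriv G) + fps_const (of_real c) * fps_deriv G) $ n"
      by (cases n) (auto simp: algebra_simps)
    also have "\<dots> = (fps_const (4 * (a * b)) * (G * J ^ 2) - (fps_X * fps_deriv G) * A) $ n"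
      unfolding eq by (simp add: mult_ac flip: fps_const_mult numeral_fps_const)
    also have "\<dots> = 4 * (a * b) * (\<Sum>k\<le>n. G $ k * (J ^ 2) $ (n - k))
        - (\<Sum>k\<le>n. of_nat k * G $ k * A $ (n - k))"
    proof -
      have "(fps_X * fps_deriv G) $ k = of_nat k * G $ k" for k by (cases k) auto
      thus ?thesis
        by (simp only: fps_sub_nth fps_mult_left_const_nth fps_mult_nth[of G]
            fps_mult_nth[of "fps_X * fps_deriv G"] atLeast0AtMost)
    qed
    finally have "norm (of_nat (n + 1) * (of_nat n + of_real c) * G $ (n + 1))
       \<le> norm (4 * (a * b) * (\<Sum>k\<le>n. G $ k * (J ^ 2) $ (n - k)))
        + norm (\<Sum>k\<le>n. of_nat k * G $ k * A $ (n - k))"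
      by (simp only: norm_triangle_ineq4)
    also have "norm (4 * (a * b) * (\<Sum>k\<le>n. G $ k * (J ^ 2) $ (n - k)))
      \<le> 4 * norm (a * b) * (\<Sum>k\<le>n. real (k + 1) * real (n - k + 1) * norm (G $ k))"
    proof -
      have "norm (G $ k * (J ^ 2) $ (n - k)) \<le> real (k + 1) * real (n - k + 1) * norm (G $ k)" for k
        using mult_mono[OF mult_mono[OF order.refl J2[of "n - k"], of "norm (G $ k)"], of 1 "real (k + 1)"]
        by (simp add: norm_mult mult_ac)
      hence "norm (\<Sum>k\<le>n. G $ k * (J ^ 2) $ (n - k))
          \<le> (\<Sum>k\<le>n. real (k + 1) * real (n - k + 1) * norm (G $ k))"
        by (intro sum_norm_le)
      moreover have "norm (4 * (a * b) * (\<Sum>k\<le>n. G $ k * (J ^ 2) $ (n - k)))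
          = 4 * norm (a * b) * norm (\<Sum>k\<le>n. G $ k * (J ^ 2) $ (n - k))"
        by (simp add: norm_mult)
      ultimately show ?thesis by (simp only:) (intro mult_left_mono; simp)
    qed
    also have "norm (\<Sum>k\<le>n. of_nat k * G $ k * A $ (n - k))
      \<le> (k1 + k2) * (\<Sum>k\<le>n. real (k + 1) * real (n - k + 1) * norm (G $ k))"
    proof -
      have "norm (of_nat k * G $ k * A $ (n - k))
          \<le> (k1 + k2) * (real (k + 1) * real (n - k + 1) * norm (G $ k))" for k
      proof -
        have "norm (of_nat k * G $ k * A $ (n - k)) = real k * norm (G $ k) * norm (A $ (n - k))"
          by (simp add: norm_mult)
        also have "\<dots> \<le> real (k + 1) * norm (G $ k) * ((k1 + k2) * real (n - k + 1))"
          by (intro mult_mono A) auto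
        finally show ?thesis by (simp add: mult_ac)
      qed
      thus ?thesis unfolding sum_distrib_left by (intro sum_norm_le)
    qed
    also have "norm (of_nat (n + 1) * (of_nat n + of_real c) * G $ (n + 1))
        = real (n + 1) * (real n + c) * norm (G $ (n + 1))"
    proof -
      have "norm (of_nat n + of_real c :: complex) = real n + c"
        using \<open>c > 0\<close> norm_of_real[of "real n + c", where 'a = complex] by simp
      thus ?thesis by (simp only: norm_mult norm_of_nat)
    qed
    finally show ?thesis by (simp add: K_def distrib_right)
  qed
  ultimately show ?thesis
    unfolding G_def[symmetric] using \<open>c > 0\<close> by (intro fps_conv_radius_ge_1_of_recurrence)
qed

lemma norm_less_fps_conv_radius:
  "fps_conv_radius f \<ge> 1 \<Longrightarrow> norm z < 1 \<Longrightarrow> ereal (norm z) < fps_conv_radius f"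
  by (rule less_le_trans[of _ 1]) auto

lemma holomorphic_on_eval_fps_unit_ball:
  fixes f :: "complex fps"
  assumes "fps_conv_radius f \<ge> 1"
  shows "eval_fps f holomorphic_on ball 0 1"
  by (rule holomorphic_on_eval_fps) (use norm_less_fps_conv_radius[OF assms] in auto)

abbreviation cut_plane :: "complex set" where
  "cut_plane \<equiv> UNIV - of_real ` {1..}"

lemma one_minus_notin_nonpos_Reals:
  assumes "z \<in> cut_plane"
  shows "1 - z \<notin> \<real>\<^sub>\<le>\<^sub>0"
proof
  assume "1 - z \<in> \<real>\<^sub>\<le>\<^sub>0"
  then obtain r where "1 - z = of_real r" "r \<le> 0" by (rule nonpos_Reals_cases)
  hence "z = of_real (1 - r)" by (simp add: algebra_simps)
  moreover have "1 - r \<in> {1..}" using \<open>r \<le> 0\<close> by simp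
  ultimately show False using assms by blast
qed

lemma ball_subset_cut_plane: "ball 0 1 \<subseteq> cut_plane"
proof -
  have "of_real x \<notin> (ball 0 1 :: complex set)" if "x \<ge> 1" for x :: real
    using that by simp
  thus ?thesis by blast
qed

text \<open>The map $w \mapsto 4w/(1+w)^2$ takes the unit disc onto the cut plane, with inverse
  $z \mapsto (1-\sqrt{1-z})/(1+\sqrt{1-z})$; in the variable $w$ the hypergeometric equation has no
  singular points in the punctured disc.\<close>
lemma hypergeo_continuation_exists:
  fixes a b :: complex and c :: real
  assumes "c > 0"
  shows "\<exists>F. F holomorphic_on cut_plane \<and>
    (\<forall>z\<in>ball 0 1. F z = eval_fps (fps_hypergeo [a, b] [of_real c] 1) z)"
proof -
  define F where "F = fps_hypergeo [a, b] [of_real c :: complex] 1"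
  define J :: "complex fps" where "J = inverse (1 + fps_X)"
  define \<Phi> where "\<Phi> = 4 * fps_X * J ^ 2"
  define \<phi> where "\<phi> = (\<lambda>w :: complex. 4 * w * (inverse (1 + w)) ^ 2)"
  define w where "w = (\<lambda>z. (1 - csqrt (1 - z)) / (1 + csqrt (1 - z)))"
  define H where "H = (\<lambda>z. eval_fps (F oo \<Phi>) (w z))"
  have J: "(1 + fps_X) * J = 1" unfolding J_def by (intro inverse_mult_eq_1') simp
  \<comment> \<open>Positivity of the real part is what puts \<open>w z\<close> in the unit disc,
    since q -> (1-q)/(1+q) maps the right half-plane there. The principal root is purely imaginary
    only for nonpositive real 1 - z, that is, on the cut.\<close>
  have re: "Re (csqrt (1 - z)) > 0" if "z \<in> cut_plane" for z
  proof (rule ccontr)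
    assume "\<not> ?thesis"
    hence "Re (csqrt (1 - z)) = 0" using csqrt_principal[of "1 - z"] by auto
    hence "csqrt (1 - z) = \<i> * of_real (Im (csqrt (1 - z)))" by (simp add: complex_eq_iff)
    hence "1 - z = (\<i> * of_real (Im (csqrt (1 - z)))) ^ 2" by (metis power2_csqrt)
    also have "\<dots> = of_real (- (Im (csqrt (1 - z)) ^ 2))" by (simp add: power_mult_distrib)
    also have "\<dots> \<in> \<real>\<^sub>\<le>\<^sub>0" by (subst complex_nonpos_Reals_iff) (simp del: of_real_minus)
    finally show False using one_minus_notin_nonpos_Reals[OF that] by blast
  qed
  have nz: "1 + csqrt (1 - z) \<noteq> 0" if "z \<in> cut_plane" for z
  proof
    assume "1 + csqrt (1 - z) = 0"
    hence "Re 1 + Re (csqrt (1 - z)) = 0" by (metis plus_complex.sel(1) zero_complex.sel(1))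
    with re[OF that] show False by (simp only: one_complex.sel)
  qed
  have hol_w: "w holomorphic_on cut_plane" unfolding w_def
    using nz one_minus_notin_nonpos_Reals by (intro holomorphic_intros) auto
  have w1: "norm (w z) < 1" if "z \<in> cut_plane" for z
  proof -
    have "norm (1 - csqrt (1 - z)) ^ 2 < norm (1 + csqrt (1 - z)) ^ 2"
      using re[OF that] unfolding cmod_power2 by (simp add: power2_eq_square algebra_simps)
    hence "norm (1 - csqrt (1 - z)) < norm (1 + csqrt (1 - z))"
      by (rule power_less_imp_less_base) simp
    thus ?thesis using nz[OF that] by (simp add: w_def norm_divide)
  qed
  have \<phi>w: "\<phi> (w z) = z" if "z \<in> cut_plane" for z
  proof -
    define q where "q = csqrt (1 - z)"
    have q: "1 + q \<noteq> 0" "q ^ 2 = 1 - z" using nz[OF that] by (auto simp: q_def)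
    have "1 + w z = 2 / (1 + q)" using q by (simp add: w_def q_def[symmetric] field_simps)
    hence "\<phi> (w z) = 4 * ((1 - q) / (1 + q)) * ((1 + q) / 2) ^ 2"
      by (simp add: \<phi>_def) (simp add: w_def q_def)
    also have "\<dots> = ((1 - q) / (1 + q)) * (1 + q) * (1 + q)" by (simp add: power2_eq_square)
    also have "\<dots> = (1 - q) * (1 + q)" using q(1) by simp
    also have "\<dots> = z" using q(2) by (simp add: algebra_simps power2_eq_square)
    finally show ?thesis .
  qed
  have rad: "fps_conv_radius (F oo \<Phi>) \<ge> 1"
    unfolding F_def \<Phi>_def by (rule fps_conv_radius_hypergeo_quadratic[OF assms J])
  have hol: "H holomorphic_on cut_plane"
  proof -
    have "eval_fps (F oo \<Phi>) \<circ> w holomorphic_on cut_plane"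
    proof (rule holomorphic_on_compose_gen[OF hol_w])
      show "eval_fps (F oo \<Phi>) holomorphic_on ball 0 1"
        by (rule holomorphic_on_eval_fps_unit_ball[OF rad])
      show "w ` cut_plane \<subseteq> ball 0 1" using w1 by auto
    qed
    thus ?thesis by (simp add: H_def o_def)
  qed
  have F_exp: "eval_fps F has_fps_expansion F"
    unfolding F_def
    by (intro eval_fps_has_fps_expansion less_le_trans[OF _ fps_conv_radius_hypergeo[OF assms]]) simp
  have \<phi>_exp: "\<phi> has_fps_expansion \<Phi>"
    unfolding \<phi>_def \<Phi>_def J_def by (intro fps_expansion_intros) auto
  have "(eval_fps F \<circ> \<phi>) has_fps_expansion (F oo \<Phi>)"
    by (intro has_fps_expansion_compose F_exp \<phi>_exp) (simp add: \<Phi>_def mult.assoc)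
  hence "eventually (\<lambda>v. eval_fps (F oo \<Phi>) v = eval_fps F (\<phi> v)) (nhds 0)"
    by (simp add: has_fps_expansion_def)
  moreover have "filterlim w (nhds 0) (nhds 0)"
  proof -
    have "isCont w 0"
      using hol_w by (intro holomorphic_on_imp_continuous_on[THEN continuous_on_interior]) 
        (auto intro!: interiorI[of "ball 0 1"] ball_subset_cut_plane)
    moreover have "w 0 = 0" by (simp add: w_def)
    ultimately show ?thesis by (metis isCont_def tendsto_at_iff_tendsto_nhds)
  qed
  ultimately have "eventually (\<lambda>z. H z = eval_fps F (\<phi> (w z))) (nhds 0)"
    unfolding H_def by (rule eventually_compose_filterlim)
  then obtain e where e: "e > 0" "\<And>z. z \<in> ball 0 e \<Longrightarrow> H z = eval_fps F (\<phi> (w z))"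
    unfolding eventually_nhds_metric by (auto simp: dist_commute)
  \<comment> \<open>Formal composition identifies \<open>H\<close> with the Gauss series only near
    the origin; the identity theorem extends this to the unit disc.\<close>
  have "H z = eval_fps F z" if "z \<in> ball 0 1" for z
  proof (rule analytic_continuation_open[of "ball 0 (min e 1)" "ball 0 1" H "eval_fps F"])
    show "H holomorphic_on ball 0 1" using hol ball_subset_cut_plane by (rule holomorphic_on_subset)
    show "eval_fps F holomorphic_on ball 0 1"
      unfolding F_def by (rule holomorphic_on_eval_fps_unit_ball[OF fps_conv_radius_hypergeo[OF assms]])
    show "H z = eval_fps F z" if z: "z \<in> ball 0 (min e 1)" for z
      using e(2)[of z] \<phi>w[of z] z ball_subset_cut_plane by auto
  qed (use e(1) that in auto)
  with hol show ?thesis unfolding F_def by blast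
qed

text \<open>Apart from the symmetry in the first two parameters, these two facts are all that later
  arguments use about the chosen function.\<close>

lemma
  fixes a b :: complex and c :: real
  assumes "c > 0"
  shows hyp2F1_holomorphic: "hyp2F1 a b (of_real c) holomorphic_on cut_plane"
    and hyp2F1_eq: "norm z < 1 \<Longrightarrow> hyp2F1 a b (of_real c) z = eval_fps (fps_hypergeo [a, b] [of_real c] 1) z"
  using someI_ex[OF hypergeo_continuation_exists[OF assms, of a b]]
  unfolding hyp2F1_def by auto

text \<open>The series is symmetric, so both sides choose from the same predicate and agree even on
  the cut.\<close>

lemma hyp2F1_commute: "hyp2F1 a b c = hyp2F1 b a c"
proof -
  have "fps_hypergeo [a, b] [c] 1 = fps_hypergeo [b, a] [c] 1" by (simp add: fps_eq_iff mult_ac)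
  thus ?thesis by (simp only: hyp2F1_def)
qed

subsection \<open>The Pfaff transformation and the contiguous relation\<close>

text \<open>The n-th term on the right contributes to the coefficient of X^N through (1+X)^(-a-n).
  What remains is the terminating sum of (c-b)_n (-N)_n / (n! (c)_n), which Chu-Vandermonde
  evaluates to (b)_N / (c)_N.\<close>

lemma fps_hypergeo_Pfaff:
  fixes a b c :: complex
  assumes c: "\<And>n. c + of_nat n \<noteq> 0"
  shows "fps_hypergeo [a, b] [c] 1 oo (fps_const (-1) * fps_X)
    = fps_binomial (-a) * (fps_hypergeo [a, c - b] [c] 1 oo (fps_X * fps_binomial (-1)))"
proof (rule fps_ext)
  fix N :: nat
  define B where "B = fps_binomial (-a)"
  define g where "g = fps_X * fps_binomial (-1 :: complex)"
  define H where "H = fps_hypergeo [a, c - b] [c] 1"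
  have g_pow: "g ^ n = fps_X ^ n * fps_binomial (- of_nat n)" for n
    by (simp add: g_def power_mult_distrib fps_binomial_power)
  have "(B * (H oo g)) $ N = (\<Sum>i=0..N. B $ i * (\<Sum>n=0..N. H $ n * (g ^ n) $ (N - i)))"
    unfolding fps_mult_nth
  proof (intro sum.cong refl arg_cong2[where f = "(*)"])
    fix i assume "i \<in> {0..N}"
    \<comment> \<open>\<open>g ^ n\<close> starts at X^n, so the terms with n > N - i vanish; a
      range independent of i allows the sums to be swapped.\<close>
    show "(H oo g) $ (N - i) = (\<Sum>n=0..N. H $ n * (g ^ n) $ (N - i))"
      unfolding fps_compose_nth
      by (rule sum.mono_neutral_left) (auto simp: g_pow fps_X_power_mult_nth)
  qed
  also have "\<dots> = (\<Sum>n=0..N. H $ n * (B * g ^ n) $ N)"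
    unfolding fps_mult_nth sum_distrib_left
    by (subst sum.swap) (simp add: mult_ac)
  also have "\<dots> = (\<Sum>n=0..N. (-1) ^ N * pochhammer a N / fact N *
      (pochhammer (c - b) n * pochhammer (- of_nat N) n / (of_nat (fact n) * pochhammer c n)))"
  proof (rule sum.cong[OF refl])
    fix n assume "n \<in> {0..N}"
    hence n: "n \<le> N" by simp
    have "B * g ^ n = fps_X ^ n * fps_binomial (-(a + of_nat n))"
      by (simp add: B_def g_pow mult_ac flip: fps_binomial_add_mult)
    hence 1: "(B * g ^ n) $ N = (-1) ^ (N - n) * pochhammer (a + of_nat n) (N - n) / fact (N - n)"
      using n by (simp add: fps_X_power_mult_nth gbinomial_pochhammer algebra_simps)
    have 2: "pochhammer a N = pochhammer a n * pochhammer (a + of_nat n) (N - n)"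
      using n by (rule pochhammer_product)
    have 3: "pochhammer (- of_nat N) n = (-1) ^ n * fact N / (fact (N - n) :: complex)"
    proof -
      have "of_nat (N choose n) = (-1) ^ n * pochhammer (- of_nat N) n / (fact n :: complex)"
        by (simp add: binomial_gbinomial gbinomial_pochhammer)
      hence "fact N / (fact n * fact (N - n)) * fact n = (-1) ^ n * pochhammer (- of_nat N :: complex) n"
        by (simp add: binomial_fact[OF n, where 'a = complex])
      hence "(-1) ^ n * (fact N / fact (N - n)) = (-1) ^ n * ((-1) ^ n * pochhammer (- of_nat N :: complex) n)"
        by simp
      thus ?thesis by (simp flip: power_mult_distrib mult.assoc)
    qed
    have 4: "(-1) ^ N = (-1) ^ (N - n) * (-1 :: complex) ^ n"
      using n by (simp flip: power_add)
    have 5: "(-1) ^ n * (-1) ^ n = (1 :: complex)" by (simp flip: power_mult_distrib)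
    have "(-1) ^ N * pochhammer a N / fact N *
      (pochhammer (c - b) n * pochhammer (- of_nat N) n / (of_nat (fact n) * pochhammer c n))
      = ((-1) ^ n * (-1) ^ n) * ((-1) ^ (N - n) * pochhammer a n * pochhammer (a + of_nat n) (N - n)
        * pochhammer (c - b) n / (fact (N - n) * fact n * pochhammer c n))"
      unfolding 2 3 4 by (simp only: times_divide_eq_left times_divide_eq_right divide_divide_eq_left
        divide_divide_eq_right of_nat_fact mult_ac) (simp add: mult_ac)
    thus "H $ n * (B * g ^ n) $ N = (-1) ^ N * pochhammer a N / fact N *
      (pochhammer (c - b) n * pochhammer (- of_nat N) n / (of_nat (fact n) * pochhammer c n))"
      unfolding 1 5 H_def fps_hypergeo_2_1_nth by (simp add: mult_ac)
  qed
  also have "\<dots> = (-1) ^ N * pochhammer a N / fact N * (pochhammer b N / pochhammer c N)"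
    unfolding sum_distrib_left[symmetric]
    using Vandermonde_pochhammer[of N c "c - b"] c by (simp add: eq_neg_iff_add_eq_0)
  also have "\<dots> = (fps_hypergeo [a, b] [c] 1 oo (fps_const (-1) * fps_X)) $ N"
    by (simp only: fps_nth_compose_linear fps_hypergeo_2_1_nth) (simp add: mult_ac)
  finally show "(fps_hypergeo [a, b] [c] 1 oo (fps_const (-1) * fps_X)) $ N
    = (fps_binomial (-a) * (fps_hypergeo [a, c - b] [c] 1 oo (fps_X * fps_binomial (-1)))) $ N"
    by (simp add: B_def H_def g_def)
qed

lemma eval_fps_hypergeo_has_fps_expansion:
  fixes c :: real
  assumes "c > 0"
  shows "eval_fps (fps_hypergeo [a, b] [of_real c :: complex] 1) has_fps_expansion fps_hypergeo [a, b] [of_real c] 1"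
  by (intro eval_fps_has_fps_expansion less_le_trans[OF _ fps_conv_radius_hypergeo[OF assms]]) simp

lemma hyp2F1_has_fps_expansion:
  fixes c :: real
  assumes "c > 0"
  shows "hyp2F1 a b (of_real c) has_fps_expansion fps_hypergeo [a, b] [of_real c] 1"
proof -
  have "eventually (\<lambda>z :: complex. z \<in> ball 0 1) (nhds 0)"
    by (intro eventually_nhds_in_open) auto
  hence "eventually (\<lambda>z. eval_fps (fps_hypergeo [a, b] [of_real c] 1) z = hyp2F1 a b (of_real c) z) (nhds 0)"
    by eventually_elim (simp add: hyp2F1_eq[OF assms])
  thus ?thesis using eval_fps_hypergeo_has_fps_expansion[OF assms, of a b]
    by (simp add: has_fps_expansion_def)
qed

lemma halfplane_subset_cut_plane: "{z. Re z < 1} \<subseteq> cut_plane"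
  by auto

text \<open>Such an x lies closer to 0 than to -1.\<close>

lemma norm_divide_one_plus_less_1:
  fixes x :: complex
  assumes "Re x > -1/2"
  shows "norm (x / (1 + x)) < 1"
proof -
  have "norm x ^ 2 < norm (1 + x) ^ 2"
    using assms unfolding cmod_power2 by (simp add: power2_eq_square algebra_simps)
  hence "norm x < norm (1 + x)" by (rule power_less_imp_less_base) simp
  moreover have "norm (1 + x) > 0" using calculation by (rule le_less_trans[OF norm_ge_zero])
  ultimately show ?thesis by (simp add: norm_divide)
qed

text \<open>The half-plane is where x/(1+x) lies in the unit disc, so that the right-hand series
  converges. It is convex and contains 0 and all x >= 0, and the formal identity spreads over it by
  the identity theorem.\<close>

lemma hyp2F1_Pfaff:
  fixes c :: real
  assumes "c > 0" "Re x > -1/2"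
  shows "hyp2F1 a b (of_real c) (-x)
    = (1 + x) powr (-a) * eval_fps (fps_hypergeo [a, of_real c - b] [of_real c] 1) (x / (1 + x))"
proof -
  define S where "S = {x :: complex. Re x > -1/2}"
  define H where "H = fps_hypergeo [a, of_real c - b] [of_real c :: complex] 1"
  define l where "l = (\<lambda>x. hyp2F1 a b (of_real c) (-x))"
  define r where "r = (\<lambda>x. (1 + x) powr (-a) * eval_fps H (x / (1 + x)))"
  have "(hyp2F1 a b (of_real c) \<circ> (\<lambda>x. (-1) * x)) has_fps_expansion
      (fps_hypergeo [a, b] [of_real c] 1 oo (fps_const (-1) * fps_X))"
    by (intro has_fps_expansion_compose hyp2F1_has_fps_expansion assms fps_expansion_intros) simp
  hence "eventually (\<lambda>x. eval_fps (fps_hypergeo [a, b] [of_real c] 1 oo (fps_const (-1) * fps_X)) x = l x) (nhds 0)"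
    by (simp add: has_fps_expansion_def l_def)
  moreover have "(\<lambda>x. (1 + x) powr (-a) * (eval_fps H \<circ> (\<lambda>x. x * inverse (1 + x))) x) has_fps_expansion
      (fps_binomial (-a) * (H oo (fps_X * fps_binomial (-1))))"
    unfolding fps_binomial_minus_one H_def
    by (intro fps_expansion_intros eval_fps_hypergeo_has_fps_expansion assms) auto
  hence "eventually (\<lambda>x. eval_fps (fps_binomial (-a) * (H oo (fps_X * fps_binomial (-1)))) x = r x) (nhds 0)"
    by (simp add: has_fps_expansion_def r_def divide_inverse)
  ultimately have "eventually (\<lambda>x. l x = r x) (nhds 0)"
    unfolding fps_hypergeo_Pfaff[OF of_real_add_of_nat_nonzero[OF \<open>c > 0\<close>]] H_def
    by eventually_elim simp
  then obtain e where e: "e > 0" "\<And>x. x \<in> ball 0 e \<Longrightarrow> l x = r x"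
    unfolding eventually_nhds_metric by (auto simp: dist_commute)
  have "l x = r x"
  proof (rule analytic_continuation_open[of "ball 0 (min e (1/2))" S l r])
    show "open S" unfolding S_def by (rule open_halfspace_Re_gt)
    show "connected S" unfolding S_def by (intro convex_connected convex_halfspace_Re_gt)
    show "ball 0 (min e (1/2)) \<subseteq> S"
    proof
      fix y :: complex assume "y \<in> ball 0 (min e (1/2))"
      thus "y \<in> S" using abs_Re_le_cmod[of y] by (auto simp: S_def)
    qed
    have "hyp2F1 a b (of_real c) \<circ> uminus holomorphic_on S"
      by (rule holomorphic_on_compose_gen[OF _ hyp2F1_holomorphic[OF \<open>c > 0\<close>]])
         (auto simp: S_def complex_eq_iff intro!: holomorphic_intros)
    thus "l holomorphic_on S" by (simp add: l_def o_def)
    have nz: "1 + x \<notin> \<real>\<^sub>\<le>\<^sub>0" "1 + x \<noteq> 0" if "x \<in> S" for x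
      using that by (auto simp: S_def complex_nonpos_Reals_iff complex_eq_iff)
    have "eval_fps H \<circ> (\<lambda>x. x / (1 + x)) holomorphic_on S"
    proof (rule holomorphic_on_compose_gen)
      show "eval_fps H holomorphic_on ball 0 1"
        unfolding H_def by (rule holomorphic_on_eval_fps_unit_ball[OF fps_conv_radius_hypergeo[OF \<open>c > 0\<close>]])
      show "(\<lambda>x. x / (1 + x)) holomorphic_on S" using nz by (auto intro!: holomorphic_intros)
      show "(\<lambda>x. x / (1 + x)) ` S \<subseteq> ball 0 1" using norm_divide_one_plus_less_1 by (auto simp: S_def)
    qed
    thus "r holomorphic_on S" unfolding r_def o_def using nz by (auto intro!: holomorphic_intros)
    show "x \<in> S" using assms by (simp add: S_def)
  qed (use e in auto)
  thus ?thesis by (simp only: l_def r_def H_def)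
qed

text \<open>After each shift is reduced to a common product of Pochhammer symbols, the coefficients
  agree because of (c-a)(b+m) - (c-b)(a+m) = (b-a)(c+m).\<close>

lemma fps_hypergeo_contiguous:
  fixes a b c :: complex
  assumes c: "\<And>n. c + of_nat n \<noteq> 0"
    and ab: "a \<noteq> b" "b - a + 1 \<noteq> 0" "a - b + 1 \<noteq> 0"
  shows "- fps_X * fps_hypergeo [a, b] [c] 1 =
    fps_const (b * (c - a) / ((b - a) * (b - a + 1)))
      * (fps_hypergeo [a - 1, b + 1] [c] 1 - fps_hypergeo [a, b] [c] 1) +
    fps_const (a * (c - b) / ((a - b) * (a - b + 1)))
      * (fps_hypergeo [a + 1, b - 1] [c] 1 - fps_hypergeo [a, b] [c] 1)" (is "_ = ?r")
proof (rule fps_ext)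
  fix n
  show "(- fps_X * fps_hypergeo [a, b] [c] 1) $ n = ?r $ n"
  proof (cases n)
    case (Suc m)
    define p q where "p = pochhammer a m" and "q = pochhammer b m"
    define D where "D = pochhammer c (Suc m) * fact (Suc m)"
    define k :: complex where "k = of_nat (Suc m)"
    \<comment> \<open>The factor \<open>b\<close> is kept so that b (b+1)_m becomes (b)_(m+1)
      without dividing by \<open>b\<close>. Generality in both parameters lets the opposite shift be
      obtained by exchanging them.\<close>
    have shift: "b * ((fps_hypergeo [a - 1, b + 1] [c] 1 - fps_hypergeo [a, b] [c] 1) $ Suc m)
        = - (b - a + 1) * (pochhammer a m * pochhammer b m * (b + of_nat m) * of_nat (Suc m) / (pochhammer c (Suc m) * fact (Suc m)))"
      for a b :: complex
    proof -
      have "b * (pochhammer (a - 1) (Suc m) * pochhammer (b + 1) (Suc m) - pochhammer a (Suc m) * pochhammer b (Suc m))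
          = (a - 1) * pochhammer a m * (b * pochhammer (b + 1) m) * (b + 1 + of_nat m)
            - b * pochhammer a (Suc m) * pochhammer b (Suc m)"
        unfolding pochhammer_rec[of "a - 1" m] pochhammer_Suc[of "b + 1" m] by (simp add: algebra_simps)
      also have "b * pochhammer (b + 1) m = pochhammer b (Suc m)" by (simp add: pochhammer_rec)
      finally have "b * (pochhammer (a - 1) (Suc m) * pochhammer (b + 1) (Suc m) - pochhammer a (Suc m) * pochhammer b (Suc m))
          = - (b - a + 1) * (pochhammer a m * pochhammer b m * (b + of_nat m) * of_nat (Suc m))"
        by (simp add: pochhammer_Suc algebra_simps)
      thus ?thesis
        unfolding fps_sub_nth fps_hypergeo_2_1_nth diff_divide_distrib[symmetric] times_divide_eq_right by simp
    qed
    have D: "pochhammer c (Suc m) = pochhammer c m * (c + of_nat m)" "fact (Suc m) = k * fact m"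
      by (simp_all add: pochhammer_Suc k_def)
    have "?r $ n = (c - a) / ((b - a) * (b - a + 1)) * (b * ((fps_hypergeo [a - 1, b + 1] [c] 1 - fps_hypergeo [a, b] [c] 1) $ n))
      + (c - b) / ((a - b) * (a - b + 1)) * (a * ((fps_hypergeo [b - 1, a + 1] [c] 1 - fps_hypergeo [b, a] [c] 1) $ n))"
      by (simp add: mult_ac)
    also have "\<dots> = - ((c - a) / (b - a) * (p * q * (b + of_nat m) * k / D)
      + (c - b) / (a - b) * (p * q * (a + of_nat m) * k / D))"
      unfolding Suc shift p_def[symmetric] q_def[symmetric] D_def[symmetric] k_def[symmetric]
      using ab by (simp add: divide_simps) (simp add: algebra_simps)
    also have "\<dots> = - (p * q * k / D * (((c - a) * (b + of_nat m) - (c - b) * (a + of_nat m)) / (b - a)))"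
      using ab by (simp add: divide_simps) (simp add: algebra_simps)
    also have "((c - a) * (b + of_nat m) - (c - b) * (a + of_nat m)) / (b - a) = c + of_nat m"
      using ab by (simp add: divide_simps) (simp add: algebra_simps)
    also have "- (p * q * k / D * (c + of_nat m)) = - (p * q / (pochhammer c m * fact m))"
      using c[of m] unfolding D_def D by (simp add: k_def divide_simps del: of_nat_Suc)
    also have "\<dots> = (- fps_X * fps_hypergeo [a, b] [c] 1) $ n"
      by (simp add: Suc p_def q_def)
    finally show ?thesis ..
  qed simp
qed

text \<open>For a = b_0 + is and b = b_0 - is, replacing s by s + i is the shift to (a - 1, b + 1),
  and s - i gives the opposite one. The half-plane is a convex part of the cut plane containing
  every argument -x.\<close>

lemma hyp2F1_contiguous:
  fixes a b :: complex and c :: real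
  assumes "c > 0" and ab: "a \<noteq> b" "b - a + 1 \<noteq> 0" "a - b + 1 \<noteq> 0" and "Re z < 1"
  shows "- z * hyp2F1 a b (of_real c) z =
    b * (of_real c - a) / ((b - a) * (b - a + 1))
      * (hyp2F1 (a - 1) (b + 1) (of_real c) z - hyp2F1 a b (of_real c) z) +
    a * (of_real c - b) / ((a - b) * (a - b + 1))
      * (hyp2F1 (a + 1) (b - 1) (of_real c) z - hyp2F1 a b (of_real c) z)"
proof -
  define S where "S = {z. Re z < 1}"
  define l where "l = (\<lambda>z. - z * hyp2F1 a b (of_real c) z)"
  define r where "r = (\<lambda>z. b * (of_real c - a) / ((b - a) * (b - a + 1))
      * (hyp2F1 (a - 1) (b + 1) (of_real c) z - hyp2F1 a b (of_real c) z) +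
    a * (of_real c - b) / ((a - b) * (a - b + 1))
      * (hyp2F1 (a + 1) (b - 1) (of_real c) z - hyp2F1 a b (of_real c) z))"
  have "l has_fps_expansion (- fps_X * fps_hypergeo [a, b] [of_real c] 1)"
    unfolding l_def by (intro fps_expansion_intros hyp2F1_has_fps_expansion assms)
  moreover have "r has_fps_expansion (- fps_X * fps_hypergeo [a, b] [of_real c] 1)"
    unfolding fps_hypergeo_contiguous[OF of_real_add_of_nat_nonzero[OF \<open>c > 0\<close>] ab] r_def
    by (intro fps_expansion_intros hyp2F1_has_fps_expansion assms)
  ultimately have "eventually (\<lambda>z. l z = r z) (nhds 0)"
    unfolding has_fps_expansion_def by (auto elim: eventually_elim2)
  then obtain e where e: "e > 0" "\<And>z. z \<in> ball 0 e \<Longrightarrow> l z = r z"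
    unfolding eventually_nhds_metric by (auto simp: dist_commute)
  have hol: "hyp2F1 a b (of_real c) holomorphic_on S" for a b
    using hyp2F1_holomorphic[OF \<open>c > 0\<close>] halfplane_subset_cut_plane unfolding S_def
    by (rule holomorphic_on_subset)
  have "l z = r z"
  proof (rule analytic_continuation_open[of "ball 0 (min e 1)" S l r])
    show "open S" unfolding S_def by (rule open_halfspace_Re_lt)
    show "connected S" unfolding S_def by (intro convex_connected convex_halfspace_Re_lt)
    show "ball 0 (min e 1) \<subseteq> S"
    proof
      fix y :: complex assume "y \<in> ball 0 (min e 1)"
      thus "y \<in> S" using abs_Re_le_cmod[of y] by (auto simp: S_def)
    qed
    show "l holomorphic_on S" "r holomorphic_on S"
      unfolding l_def r_def by (intro holomorphic_intros hol)+
  qed (use e \<open>Re z < 1\<close> in \<open>auto simp: S_def\<close>)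
  thus ?thesis by (simp only: l_def r_def)
qed

subsection \<open>Growth and dependence on the parameters\<close>

lemma norm_eval_fps_hypergeo_le:
  fixes y \<delta> C :: real
  assumes "\<And>n. norm (fps_hypergeo [a, b] [c :: complex] 1 $ n) \<le> C * (pochhammer \<delta> n / fact n)"
    and y: "0 \<le> y" "y < 1"
  shows "norm (eval_fps (fps_hypergeo [a, b] [c] 1) (of_real y)) \<le> C * (1 - y) powr (-\<delta>)"
proof -
  have sums: "(\<lambda>n. C * (pochhammer \<delta> n / fact n * y ^ n)) sums (C * (1 - y) powr (-\<delta>))"
    using y by (intro sums_mult pochhammer_sums) auto
  have "norm (\<Sum>n. fps_hypergeo [a, b] [c] 1 $ n * of_real y ^ n) \<le> (\<Sum>n. C * (pochhammer \<delta> n / fact n * y ^ n))"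
  proof (rule norm_suminf_le)
    show "norm (fps_hypergeo [a, b] [c] 1 $ n * of_real y ^ n) \<le> C * (pochhammer \<delta> n / fact n * y ^ n)" for n
      using mult_right_mono[OF assms(1)[of n], of "y ^ n"] y
      by (simp add: norm_mult norm_power mult_ac del: fps_hypergeo_nth)
    show "summable (\<lambda>n. C * (pochhammer \<delta> n / fact n * y ^ n))"
      using sums by (rule sums_summable)
  qed
  thus ?thesis using sums by (simp add: eval_fps_def sums_iff del: fps_hypergeo_nth)
qed

lemma hyp2F1_Pfaff_real:
  fixes c x :: real
  assumes "c > 0" "x \<ge> 0"
  shows "hyp2F1 a b (of_real c) (- of_real x)
    = of_real (1 + x) powr (-a)
      * eval_fps (fps_hypergeo [a, of_real c - b] [of_real c] 1) (of_real (x / (1 + x)))"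
  using hyp2F1_Pfaff[OF \<open>c > 0\<close>, of "of_real x" a b] assms(2) by (simp del: fps_hypergeo_nth)

text \<open>If Re a <= Re b, the Pfaff parameters a and c - b have sum of real part at most c, so
  every \<delta> > 0 is admissible in the coefficient bound; otherwise the parameters are exchanged,
  whence the minimum. The positive \<delta> absorbs the logarithm that can occur for a = b.\<close>

lemma hyp2F1_growth:
  fixes c \<delta> R :: real
  assumes "c > 0" "\<delta> > 0"
  obtains C where "C \<ge> 0"
    "\<And>a b x. norm a \<le> R \<Longrightarrow> norm b \<le> R \<Longrightarrow> x \<ge> 0 \<Longrightarrow>
       norm (hyp2F1 a b (of_real c) (- of_real x)) \<le> C * (1 + x) powr (\<delta> - min (Re a) (Re b))"
proof -
  have "c < c + \<delta>" using assms by simp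
  \<comment> \<open>The radius is \<open>R + c\<close> because the bound is applied to
    \<open>c - b\<close> in place of \<open>b\<close>.\<close>
  then obtain C where C: "C \<ge> 0" "\<And>a b n. norm a \<le> R + c \<Longrightarrow> norm b \<le> R + c \<Longrightarrow> Re (a + b) \<le> c \<Longrightarrow>
      norm (fps_hypergeo [a, b] [of_real c] 1 $ n) \<le> C * (pochhammer \<delta> n / fact n)"
    using fps_hypergeo_nth_bound[OF assms, of c "R + c"] by metis
  have *: "norm (hyp2F1 a b (of_real c) (- of_real x)) \<le> C * (1 + x) powr (\<delta> - Re a)"
    if "norm a \<le> R" "norm b \<le> R" "x \<ge> 0" "Re a \<le> Re b" for a b and x :: real
  proof -
    have nb: "norm (of_real c - b) \<le> R + c"
      using norm_triangle_ineq4[of "of_real c" b] that \<open>c > 0\<close> by simp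
    have "norm (eval_fps (fps_hypergeo [a, of_real c - b] [of_real c] 1) (of_real (x / (1 + x))))
        \<le> C * (1 - x / (1 + x)) powr (-\<delta>)"
      using that nb \<open>c > 0\<close>
      by (intro norm_eval_fps_hypergeo_le C) auto
    also have "1 - x / (1 + x) = inverse (1 + x)" using that by (simp add: field_simps)
    also have "inverse (1 + x) powr (-\<delta>) = (1 + x) powr \<delta>"
      using that by (simp add: powr_minus inverse_powr)
    finally have "norm (hyp2F1 a b (of_real c) (- of_real x)) \<le> (1 + x) powr (- Re a) * (C * (1 + x) powr \<delta>)"
      unfolding hyp2F1_Pfaff_real[OF \<open>c > 0\<close> \<open>x \<ge> 0\<close>] norm_mult
      using that by (intro mult_mono) (auto simp: norm_powr_real_powr simp del: fps_hypergeo_nth of_real_add)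
    also have "\<dots> = C * (1 + x) powr (\<delta> - Re a)"
      using that by (simp add: powr_diff powr_minus field_simps)
    finally show ?thesis .
  qed
  show ?thesis
  proof (rule that[OF C(1)])
    fix a b :: complex and x :: real
    assume ab: "norm a \<le> R" "norm b \<le> R" "x \<ge> 0"
    show "norm (hyp2F1 a b (of_real c) (- of_real x)) \<le> C * (1 + x) powr (\<delta> - min (Re a) (Re b))"
    proof (cases "Re a \<le> Re b")
      case True
      thus ?thesis using *[OF ab] by (simp add: min_def)
    next
      case False
      thus ?thesis using *[OF ab(2,1,3)] by (simp add: min_def hyp2F1_commute[of a b])
    qed
  qed
qed

text \<open>The definition chooses a function of z for each parameter pair and gives no control
  across pairs. For fixed x the Pfaff formula replaces it by an explicit series at a point y < 1,
  which converges locally uniformly in s.\<close>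

lemma hyp2F1_holomorphic_parameters:
  fixes c x :: real
  assumes "c > 0" "x \<ge> 0" "open S" "A holomorphic_on S" "B holomorphic_on S"
  shows "(\<lambda>s. hyp2F1 (A s) (B s) (of_real c) (- of_real x)) holomorphic_on S"
proof -
  define y where "y = x / (1 + x)"
  have y: "0 \<le> y" "y < 1" using assms by (auto simp: y_def)
  define B' where "B' = (\<lambda>s. of_real c - B s)"
  have hol: "A holomorphic_on S" "B' holomorphic_on S"
    using assms by (auto simp: B'_def intro!: holomorphic_intros)
  have "(\<lambda>s. \<Sum>i. fps_hypergeo [A s, B' s] [of_real c] 1 $ i * of_real y ^ i) holomorphic_on S"
  proof (rule holomorphic_uniform_sequence[OF \<open>open S\<close>])
    show "(\<lambda>s. \<Sum>i<n. fps_hypergeo [A s, B' s] [of_real c] 1 $ i * of_real y ^ i) holomorphic_on S" for n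
      unfolding fps_hypergeo_2_1_nth pochhammer_prod
      using pochhammer_of_real_nonzero[OF \<open>c > 0\<close>]
      by (intro holomorphic_intros hol) (auto simp: pochhammer_prod)
    fix s0 assume "s0 \<in> S"
    then obtain d where d: "d > 0" "cball s0 d \<subseteq> S"
      using \<open>open S\<close> open_contains_cball by blast
    have bdd: "\<exists>K. \<forall>s\<in>cball s0 d. norm (f s) \<le> K" if "f holomorphic_on S" for f
    proof -
      have "continuous_on (cball s0 d) f"
        using that d by (meson holomorphic_on_imp_continuous_on continuous_on_subset)
      hence "bounded (f ` cball s0 d)" by (intro compact_imp_bounded compact_continuous_image) auto
      thus ?thesis by (auto simp: bounded_iff)
    qed
    obtain KA KB where K: "\<And>s. s \<in> cball s0 d \<Longrightarrow> norm (A s) \<le> KA" "\<And>s. s \<in> cball s0 d \<Longrightarrow> norm (B' s) \<le> KB"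
      using bdd[OF hol(1)] bdd[OF hol(2)] by blast
    define R where "R = max KA KB"
    have R: "norm (A s) \<le> R" "norm (B' s) \<le> R" "Re (A s + B' s) \<le> 2 * R" if "s \<in> cball s0 d" for s
      using K[OF that] complex_Re_le_cmod[of "A s"] complex_Re_le_cmod[of "B' s"] by (auto simp: R_def)
    \<comment> \<open>Since y is fixed, crude values suffice: 2R bounds the real part of the sum,
      and \<delta> is taken large enough to satisfy the strict inequality of the coefficient
      bound.\<close>
    obtain C where C: "\<And>a b n. norm a \<le> R \<Longrightarrow> norm b \<le> R \<Longrightarrow> Re (a + b) \<le> 2 * R \<Longrightarrow>
        norm (fps_hypergeo [a, b] [of_real c] 1 $ n) \<le> C * (pochhammer (2 * \<bar>R\<bar> + 1) n / fact n)"
    proof -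
      have "2 * \<bar>R\<bar> + 1 > 0" "2 * R < c + (2 * \<bar>R\<bar> + 1)" using \<open>c > 0\<close> by auto
      from fps_hypergeo_nth_bound[OF \<open>c > 0\<close> this, of R] show ?thesis using that by metis
    qed
    have "uniform_limit (cball s0 d) (\<lambda>n s. \<Sum>i<n. fps_hypergeo [A s, B' s] [of_real c] 1 $ i * of_real y ^ i)
      (\<lambda>s. \<Sum>i. fps_hypergeo [A s, B' s] [of_real c] 1 $ i * of_real y ^ i) sequentially"
    proof (rule Weierstrass_m_test)
      show "norm (fps_hypergeo [A s, B' s] [of_real c] 1 $ i * of_real y ^ i)
        \<le> C * (pochhammer (2 * \<bar>R\<bar> + 1) i / fact i * y ^ i)" if "s \<in> cball s0 d" for i s
        using mult_right_mono[OF C[OF R[OF that], of i], of "y ^ i"] y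
        by (simp add: norm_mult norm_power mult_ac del: fps_hypergeo_nth)
      show "summable (\<lambda>i. C * (pochhammer (2 * \<bar>R\<bar> + 1) i / fact i * y ^ i))"
        using y by (intro summable_mult sums_summable[OF pochhammer_sums]) auto
    qed
    with d show "\<exists>d>0. cball s0 d \<subseteq> S \<and> uniform_limit (cball s0 d)
        (\<lambda>n s. \<Sum>i<n. fps_hypergeo [A s, B' s] [of_real c] 1 $ i * of_real y ^ i)
        (\<lambda>s. \<Sum>i. fps_hypergeo [A s, B' s] [of_real c] 1 $ i * of_real y ^ i) sequentially" by blast
  qed
  hence "(\<lambda>s. of_real (1 + x) powr (- A s) *
      (\<Sum>i. fps_hypergeo [A s, B' s] [of_real c] 1 $ i * of_real y ^ i)) holomorphic_on S"
    using assms by (intro holomorphic_intros) auto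
  thus ?thesis
    unfolding hyp2F1_Pfaff_real[OF \<open>c > 0\<close> \<open>x \<ge> 0\<close>] eval_fps_def B'_def y_def .
qed

subsection \<open>The index transform\<close>

text \<open>A closed disc of radius r/4 about any point of the half-size ball stays inside the full
  ball. Cauchy's inequality thus bounds the derivative by 4D/r there, and the mean value inequality
  applies by convexity.\<close>

lemma norm_diff_le_of_holomorphic_bound:
  fixes f :: "complex \<Rightarrow> complex"
  assumes "f holomorphic_on ball s r" "r > 0" "\<And>t. t \<in> ball s r \<Longrightarrow> norm (f t) \<le> D"
    and "t \<in> ball s (r / 2)"
  shows "norm (f t - f s) \<le> 4 * D / r * norm (t - s)"
proof (rule field_differentiable_bound)
  show "convex (ball s (r / 2))" by simp
  fix w assume w: "w \<in> ball s (r / 2)"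
  have sub: "cball w (r / 4) \<subseteq> ball s r"
  proof
    fix v assume "v \<in> cball w (r / 4)"
    thus "v \<in> ball s r" using w dist_triangle[of s v w] \<open>r > 0\<close> by simp
  qed
  have "w \<in> ball s r" using w \<open>r > 0\<close> by simp
  thus "(f has_field_derivative deriv f w) (at w within ball s (r / 2))"
    using holomorphic_derivI[OF assms(1) open_ball] by (blast intro: has_field_derivative_at_within)
  have "norm ((deriv ^^ 1) f w) \<le> fact 1 * D / (r / 4) ^ 1"
  proof (rule Cauchy_inequality)
    show "f holomorphic_on ball w (r / 4)"
      using assms(1) by (rule holomorphic_on_subset) (use sub in force)
    show "continuous_on (cball w (r / 4)) f"
      using assms(1) sub by (meson holomorphic_on_imp_continuous_on continuous_on_subset)
    show "norm (f v) \<le> D" if "norm (w - v) = r / 4" for v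
      using that sub by (intro assms(3)) (auto simp: dist_norm)
  qed (use \<open>r > 0\<close> in auto)
  thus "norm (deriv f w) \<le> 4 * D / r" by (simp add: field_simps)
qed (use assms in auto)

text \<open>Dominated convergence is applied to difference quotients. A local majorant of
  \<open>h\<close> is enough, with no assumption on its derivative, because the Cauchy estimate
  above turns it into a majorant of the quotients.\<close>

lemma holomorphic_on_lebesgue_integral:
  fixes h :: "complex \<Rightarrow> 'a \<Rightarrow> complex"
  assumes "open S"
    and hol: "\<And>x. x \<in> space M \<Longrightarrow> (\<lambda>s. h s x) holomorphic_on S"
    and meas: "\<And>s. s \<in> S \<Longrightarrow> h s \<in> borel_measurable M"
    and dom: "\<And>s. s \<in> S \<Longrightarrow> \<exists>r>0. \<exists>D. ball s r \<subseteq> S \<and> integrable M D \<and>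
      (\<forall>t\<in>ball s r. \<forall>x\<in>space M. norm (h t x) \<le> D x)"
  shows "(\<lambda>s. integral\<^sup>L M (h s)) holomorphic_on S"
proof -
  have int: "integrable M (h s)" if s: "s \<in> S" for s
  proof -
    obtain r D where rD: "r > 0" "integrable M D" "\<And>t x. t \<in> ball s r \<Longrightarrow> x \<in> space M \<Longrightarrow> norm (h t x) \<le> D x"
      using dom[OF s] by blast
    show ?thesis
      using rD(2) meas[OF s]
    proof (rule Bochner_Integration.integrable_bound)
      show "AE x in M. norm (h s x) \<le> norm (D x)"
        using rD(3)[of s] \<open>r > 0\<close> by (intro AE_I2) (smt (verit) centre_in_ball real_norm_def)
    qed
  qed
  have "\<exists>L. ((\<lambda>s. integral\<^sup>L M (h s)) has_field_derivative L) (at s)" if s: "s \<in> S" for s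
  proof -
    obtain r D where r: "r > 0" "ball s r \<subseteq> S" and D: "integrable M D"
        "\<And>t x. t \<in> ball s r \<Longrightarrow> x \<in> space M \<Longrightarrow> norm (h t x) \<le> D x"
      using dom[OF s] by blast
    define q where "q = (\<lambda>t x. (h t x - h s x) / (t - s))"
    define h' where "h' = (\<lambda>x. deriv (\<lambda>t. h t x) s)"
    have lim: "((\<lambda>t. q t x) \<longlongrightarrow> h' x) (at s)" if "x \<in> space M" for x
      using holomorphic_derivI[OF hol[OF that] \<open>open S\<close> s]
      by (simp add: q_def h'_def has_field_derivative_iff)
    \<comment> \<open>Restricting to the half-size ball makes every member of an approximating
      sequence obey the quotient bound; the ball is open, so the limit is unaffected.\<close>
    have "((\<lambda>t. integral\<^sup>L M (q t)) \<longlongrightarrow> integral\<^sup>L M h') (at s within ball s (r / 2))"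
      unfolding tendsto_at_iff_sequentially o_def
    proof (intro allI impI)
      fix X :: "nat \<Rightarrow> complex"
      assume X: "\<forall>i. X i \<in> ball s (r / 2) - {s}" "X \<longlonglongrightarrow> s"
      have Xr: "X i \<in> ball s r" "X i \<in> S" for i using X(1)[rule_format, of i] r by (auto simp: subset_iff)
      have lim': "(\<lambda>i. q (X i) x) \<longlonglongrightarrow> h' x" if "x \<in> space M" for x
        using lim[OF that] X by (auto simp: tendsto_at_iff_sequentially o_def)
      have meas_q: "q (X i) \<in> borel_measurable M" for i
        unfolding q_def using meas[OF Xr(2)] meas[OF s] by measurable
      show "(\<lambda>i. integral\<^sup>L M (q (X i))) \<longlonglongrightarrow> integral\<^sup>L M h'"
      proof (rule integral_dominated_convergence[where w = "\<lambda>x. 4 * D x / r"])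
        show "h' \<in> borel_measurable M"
          by (rule borel_measurable_LIMSEQ_metric[OF meas_q lim'])
        show "integrable M (\<lambda>x. 4 * D x / r)" using D(1) by simp
        show "AE x in M. norm (q (X i) x) \<le> 4 * D x / r" for i
        proof (rule AE_I2)
          fix x assume x: "x \<in> space M"
          have "norm (h (X i) x - h s x) \<le> 4 * D x / r * norm (X i - s)"
            using X(1) r D(2) x
            by (intro norm_diff_le_of_holomorphic_bound holomorphic_on_subset[OF hol]) auto
          thus "norm (q (X i) x) \<le> 4 * D x / r"
            using X(1) by (simp add: q_def norm_divide divide_le_eq)
        qed
      qed (use meas_q lim' in auto)
    qed
    hence "((\<lambda>t. integral\<^sup>L M (q t)) \<longlongrightarrow> integral\<^sup>L M h') (at s)"
      using r by (simp add: at_within_open[of s "ball s (r / 2)"])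
    moreover have "eventually (\<lambda>t. integral\<^sup>L M (q t) = (integral\<^sup>L M (h t) - integral\<^sup>L M (h s)) / (t - s)) (at s)"
      using eventually_at_in_open'[OF \<open>open S\<close> s]
      by eventually_elim (simp add: q_def int s)
    ultimately have "((\<lambda>t. (integral\<^sup>L M (h t) - integral\<^sup>L M (h s)) / (t - s)) \<longlongrightarrow> integral\<^sup>L M h') (at s)"
      by (rule Lim_transform_eventually)
    thus ?thesis by (auto simp: has_field_derivative_iff)
  qed
  thus ?thesis using \<open>open S\<close> by (simp add: holomorphic_on_open)
qed

text \<open>The integrand of the beta integral B(p, \<eta>), dominated by x^(p-1) on [0,1] and by
  x^(-1-\<eta>) on the rest.\<close>

lemma set_integrable_powr_times_one_plus_powr:
  fixes p \<eta> :: real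
  assumes "p > 0" "\<eta> > 0"
  shows "set_integrable lborel {0..} (\<lambda>x. x powr (p - 1) * (1 + x) powr (- p - \<eta>))"
proof -
  \<comment> \<open>The power integrals are available as gauge integrals; nonnegativity makes them
    absolutely convergent.\<close>
  have pow: "set_integrable lborel A (\<lambda>x. x powr e)"
    if "(\<lambda>x. x powr e) integrable_on A" "A \<in> sets borel" for e :: real and A
  proof -
    have "set_integrable lebesgue A (\<lambda>x. x powr e)"
      using that(1) by (rule nonnegative_absolutely_integrable_1) simp
    thus ?thesis unfolding set_integrable_def
      by (subst (asm) integrable_completion) (use that(2) in measurable)
  qed
  have "set_integrable lborel {0..1} (\<lambda>x. x powr (p - 1))"
    using assms by (intro pow integrable_on_powr_from_0) auto
  moreover have "set_integrable lborel {1..} (\<lambda>x. x powr (-1 - \<eta>))"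
    using has_integral_powr_to_inf[of "-1 - \<eta>" 1] assms by (intro pow) (auto simp: integrable_on_def)
  ultimately have sum: "integrable lborel (\<lambda>x. indicator {0..1} x * x powr (p - 1) + indicator {1..} x * x powr (-1 - \<eta>))"
    unfolding set_integrable_def by auto
  have bound: "x powr (p - 1) * (1 + x) powr (- p - \<eta>)
      \<le> indicator {0..1} x * x powr (p - 1) + indicator {1..} x * x powr (-1 - \<eta>)" if "x \<ge> 0" for x :: real
  proof (cases "x \<le> 1")
    case True
    have "(1 + x) powr (- p - \<eta>) \<le> (1 + x) powr 0" using that assms by (intro powr_mono) auto
    hence "x powr (p - 1) * (1 + x) powr (- p - \<eta>) \<le> x powr (p - 1) * 1"
      using that by (intro mult_left_mono) auto
    thus ?thesis using True that by (auto simp: indicator_def intro: add_increasing2)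
  next
    case False
    have "x powr (p - 1) * (1 + x) powr (- p - \<eta>) \<le> x powr (p - 1) * x powr (- p - \<eta>)"
      using False assms by (intro mult_left_mono powr_mono2') auto
    also have "\<dots> = x powr (-1 - \<eta>)" using False by (simp flip: powr_add)
    finally show ?thesis using False by (simp add: indicator_def)
  qed
  show ?thesis unfolding set_integrable_def
  proof (rule Bochner_Integration.integrable_bound[OF sum])
    show "AE x in lborel. norm (indicator {0..} x *\<^sub>R (x powr (p - 1) * (1 + x) powr (- p - \<eta>)))
      \<le> norm (indicator {0..1} x * x powr (p - 1) + indicator {1..} x * x powr (-1 - \<eta>))"
    proof (rule AE_I2)
      fix x :: real
      show "norm (indicator {0..} x *\<^sub>R (x powr (p - 1) * (1 + x) powr (- p - \<eta>)))
        \<le> norm (indicator {0..1} x * x powr (p - 1) + indicator {1..} x * x powr (-1 - \<eta>))"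
        using order.trans[OF bound[of x] abs_ge_self] by (cases "x \<ge> 0") (simp_all add: indicator_def)
    qed
  qed measurable
qed

text \<open>The gap \<kappa> - |Im s| is split into four parts r: one for moving t within the ball,
  one for the loss \<delta> = r in the growth of the kernel, and two left over as the margin of
  integrability.\<close>

lemma index_integrand_local_bound:
  fixes b c \<kappa> M :: real and f :: "real \<Rightarrow> complex"
  assumes "b > 0" "c > 0"
    and f: "\<And>x. x \<ge> 0 \<Longrightarrow> norm (f x) \<le> M * (1 + x) powr (- b - \<kappa>)"
    and s: "\<bar>Im s\<bar> < \<kappa>"
  defines "r \<equiv> (\<kappa> - \<bar>Im s\<bar>) / 4"
  obtains K where "\<And>t x. t \<in> ball s r \<Longrightarrow> x \<ge> 0 \<Longrightarrow> norm (index_integrand b c f t x)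
      \<le> K * (x powr (b + c - 1) * (1 + x) powr (- (b + c) - 2 * r))"
proof -
  have r: "r > 0" using s by (simp add: r_def)
  \<comment> \<open>At x = 0 the weight equals 1, so the decay bound forces \<open>M\<close> to be
    nonnegative.\<close>
  have "M * 1 \<ge> 0" using f[of 0] order.trans[OF norm_ge_zero f[of 0]] by simp
  hence M: "M \<ge> 0" by simp
  have "b + c > 0" using assms by simp
  then obtain C where C: "C \<ge> 0" "\<And>u v x. norm u \<le> b + norm s + r \<Longrightarrow> norm v \<le> b + norm s + r \<Longrightarrow> x \<ge> 0 \<Longrightarrow>
       norm (hyp2F1 u v (of_real (b + c)) (- of_real x)) \<le> C * (1 + x) powr (r - min (Re u) (Re v))"
    using hyp2F1_growth[OF _ r, of "b + c" "b + norm s + r"] by metis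
  show ?thesis
  proof (rule that)
    fix t x assume t: "t \<in> ball s r" and x: "(x :: real) \<ge> 0"
    define u v where "u = of_real b + \<i> * t" and "v = of_real b - \<i> * t"
    have t': "norm (t - s) \<le> r" using t by (simp add: dist_norm norm_minus_commute)
    have Imt: "\<bar>Im t\<bar> \<le> \<bar>Im s\<bar> + r"
      using abs_Im_le_cmod[of "t - s"] t' by simp
    have "norm t \<le> norm s + r" using norm_triangle_sub[of t s] t' by simp
    hence "norm u \<le> b + norm s + r" "norm v \<le> b + norm s + r"
      unfolding u_def v_def using \<open>b > 0\<close>
      by (auto intro!: order.trans[OF norm_triangle_ineq] order.trans[OF norm_triangle_ineq4] simp: norm_mult)
    hence "norm (hyp2F1 u v (of_real (b + c)) (- of_real x)) \<le> C * (1 + x) powr (r - min (Re u) (Re v))"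
      using x by (rule C)
    also have "\<dots> \<le> C * (1 + x) powr (2 * r + \<bar>Im s\<bar> - b)"
      using Imt C(1) x by (intro mult_left_mono powr_mono) (auto simp: u_def v_def)
    finally have F: "norm (hyp2F1 u v (of_real (b + c)) (- of_real x)) \<le> C * (1 + x) powr (2 * r + \<bar>Im s\<bar> - b)" .
    have "norm (index_integrand b c f t x)
        = norm (f x) * norm (hyp2F1 u v (of_real (b + c)) (- of_real x)) * x powr (b + c - 1) * (1 + x) powr (b - c)"
      by (simp add: index_integrand_def norm_mult u_def v_def)
    also have "\<dots> \<le> (M * (1 + x) powr (- b - \<kappa>)) * (C * (1 + x) powr (2 * r + \<bar>Im s\<bar> - b))
        * x powr (b + c - 1) * (1 + x) powr (b - c)"
      using M C(1) by (intro mult_right_mono mult_mono f F x) auto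
    also have "\<dots> = M * C * (x powr (b + c - 1)
        * ((1 + x) powr (- b - \<kappa>) * (1 + x) powr (2 * r + \<bar>Im s\<bar> - b) * (1 + x) powr (b - c)))"
      by (simp add: mult_ac)
    also have "(1 + x) powr (- b - \<kappa>) * (1 + x) powr (2 * r + \<bar>Im s\<bar> - b) * (1 + x) powr (b - c)
        = (1 + x) powr (- (b + c) - 2 * r)"
      using x by (simp flip: powr_add) (simp add: r_def field_simps)
    finally show "norm (index_integrand b c f t x)
        \<le> (M * C) * (x powr (b + c - 1) * (1 + x) powr (- (b + c) - 2 * r))" .
  qed
qed

lemma index_integrand_measurable:
  fixes b c :: real and f :: "real \<Rightarrow> complex"
  assumes "b > 0" "c > 0" "continuous_on {0..} f"
  shows "(\<lambda>x. indicator {0..} x *\<^sub>R index_integrand b c f s x) \<in> borel_measurable lborel"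
proof -
  define F where "F = hyp2F1 (of_real b + \<i> * s) (of_real b - \<i> * s) (of_real (b + c))"
  have "continuous_on cut_plane F"
    unfolding F_def using assms by (intro holomorphic_on_imp_continuous_on hyp2F1_holomorphic) simp
  hence "continuous_on {0..} (\<lambda>x. F (- of_real x))"
  proof (rule continuous_on_compose2)
    show "(\<lambda>x. - of_real x) ` {0..} \<subseteq> cut_plane"
      by (auto simp flip: of_real_minus)
  qed (intro continuous_intros)
  hence "(\<lambda>x. indicator {0..} x *\<^sub>R (f x * F (- of_real x))) \<in> borel_measurable borel"
    using assms by (intro borel_measurable_continuous_on_indicator continuous_intros) auto
  \<comment> \<open>The power of x is multiplied in afterwards as a measurable factor: it is
    discontinuous at 0 when b + c <= 1.\<close>
  hence "(\<lambda>x. (indicator {0..} x *\<^sub>R (f x * F (- of_real x))) * of_real (x powr (b + c - 1)) * of_real ((1 + x) powr (b - c)))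
      \<in> borel_measurable borel"
    by measurable
  thus ?thesis by (simp add: index_integrand_def F_def mult_ac)
qed

text \<open>One local majorant yields both integrability and holomorphy of the integral.\<close>

lemma
  fixes b c \<kappa> M :: real and f :: "real \<Rightarrow> complex"
  assumes "b > 0" "c > 0" "continuous_on {0..} f"
    and f: "\<And>x. x \<ge> 0 \<Longrightarrow> norm (f x) \<le> M * (1 + x) powr (- b - \<kappa>)"
  shows index_integrand_integrable:
      "\<bar>Im s\<bar> < \<kappa> \<Longrightarrow> set_integrable lborel {0..} (index_integrand b c f s)"
    and index_transform_holomorphic: "index_transform b c f holomorphic_on {s. \<bar>Im s\<bar> < \<kappa>}"
proof -
  define h where "h = (\<lambda>s x. indicator {0..} x *\<^sub>R index_integrand b c f s x)"
  define S where "S = {s. \<bar>Im s\<bar> < \<kappa>}"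
  have meas: "h s \<in> borel_measurable lborel" for s
    unfolding h_def by (rule index_integrand_measurable) fact+
  have dom: "\<exists>r>0. \<exists>D. ball s r \<subseteq> S \<and> integrable lborel D \<and>
      (\<forall>t\<in>ball s r. \<forall>x\<in>space lborel. norm (h t x) \<le> D x)" if s: "s \<in> S" for s
  proof -
    define r where "r = (\<kappa> - \<bar>Im s\<bar>) / 4"
    have r: "r > 0" using s by (simp add: r_def S_def)
    have "\<bar>Im s\<bar> < \<kappa>" using s by (simp add: S_def)
    then obtain K where K: "\<And>t x. t \<in> ball s r \<Longrightarrow> x \<ge> 0 \<Longrightarrow> norm (index_integrand b c f t x)
        \<le> K * (x powr (b + c - 1) * (1 + x) powr (- (b + c) - 2 * r))"
      using index_integrand_local_bound[OF \<open>b > 0\<close> \<open>c > 0\<close> f] unfolding r_def by metis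
    have "ball s r \<subseteq> S"
    proof
      fix t assume "t \<in> ball s r"
      hence "norm (t - s) < r" by (simp add: dist_norm norm_minus_commute)
      hence "\<bar>Im t\<bar> < \<bar>Im s\<bar> + r" using abs_Im_le_cmod[of "t - s"] by simp
      also have "\<dots> \<le> \<kappa>" using r by (simp add: r_def field_simps)
      finally show "t \<in> S" by (simp add: S_def)
    qed
    moreover have "integrable lborel (\<lambda>x. indicator {0..} x *\<^sub>R
        (K * (x powr (b + c - 1) * (1 + x) powr (- (b + c) - 2 * r))))"
      using set_integrable_powr_times_one_plus_powr[of "b + c" "2 * r"] r assms
      unfolding set_integrable_def[symmetric] by (intro set_integrable_mult_right) auto
    moreover have "norm (h t x) \<le> indicator {0..} x *\<^sub>R
        (K * (x powr (b + c - 1) * (1 + x) powr (- (b + c) - 2 * r)))" if "t \<in> ball s r" for t x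
      using K[OF that, of x] by (auto simp: h_def indicator_def)
    ultimately show ?thesis using r by blast
  qed
  show "set_integrable lborel {0..} (index_integrand b c f s)" if s: "\<bar>Im s\<bar> < \<kappa>" for s
  proof -
    obtain r D where rD: "r > 0" "integrable lborel D" "\<And>t x. t \<in> ball s r \<Longrightarrow> norm (h t x) \<le> D x"
      using dom[of s] s unfolding S_def by auto
    have "integrable lborel (h s)"
      using rD(2) meas
    proof (rule Bochner_Integration.integrable_bound)
      show "AE x in lborel. norm (h s x) \<le> norm (D x)"
        using rD(3)[of s] \<open>r > 0\<close> by (intro AE_I2) (smt (verit) centre_in_ball real_norm_def)
    qed
    thus ?thesis by (simp add: set_integrable_def h_def)
  qed
  have "(\<lambda>s. integral\<^sup>L lborel (h s)) holomorphic_on S"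
  proof (rule holomorphic_on_lebesgue_integral)
    have "S = {s. Im s < \<kappa>} \<inter> {s. Im s > -\<kappa>}" by (auto simp: S_def abs_less_iff)
    thus S: "open S" by (simp add: open_Int open_halfspace_Im_lt open_halfspace_Im_gt)
    show "(\<lambda>s. h s x) holomorphic_on S" for x
    proof (cases "x \<ge> 0")
      case True
      have "(\<lambda>s. hyp2F1 (of_real b + \<i> * s) (of_real b - \<i> * s) (of_real (b + c)) (- of_real x)) holomorphic_on S"
        using True assms S by (intro hyp2F1_holomorphic_parameters holomorphic_intros) auto
      thus ?thesis using True
        unfolding h_def index_integrand_def by (auto intro!: holomorphic_intros)
    qed (simp add: h_def)
  qed (use meas dom in auto)
  thus "index_transform b c f holomorphic_on {s. \<bar>Im s\<bar> < \<kappa>}"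
    unfolding index_transform_def set_lebesgue_integral_def h_def S_def by (intro holomorphic_intros)
qed

text \<open>The asymptotic hypothesis controls large x and compactness the rest; the weight 1 + x
  avoids the singularity of the power at 0.\<close>

lemma smallo_powr_imp_bound:
  fixes f :: "real \<Rightarrow> complex" and q :: real
  assumes "continuous_on {0..} f" "f \<in> o[at_top](\<lambda>x. of_real (x powr (- q)))" "q \<ge> 0"
  obtains M where "\<And>x. x \<ge> 0 \<Longrightarrow> norm (f x) \<le> M * (1 + x) powr (- q)"
proof -
  have "eventually (\<lambda>x. norm (f x) \<le> 1 * norm (complex_of_real (x powr (- q)))) at_top"
    using assms(2) by (rule landau_o.smallD) simp
  then obtain X where X: "\<And>x. x \<ge> X \<Longrightarrow> norm (f x) \<le> x powr (- q)"
    by (auto simp: eventually_at_top_linorder)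
  define Y where "Y = max X 1"
  have "continuous_on {0..Y} (\<lambda>x. f x * of_real ((1 + x) powr q))"
    using assms by (intro continuous_intros continuous_on_subset[OF assms(1)]) auto
  hence "bounded ((\<lambda>x. f x * of_real ((1 + x) powr q)) ` {0..Y})"
    by (intro compact_imp_bounded compact_continuous_image) auto
  then obtain B where B: "\<And>x. x \<in> {0..Y} \<Longrightarrow> norm (f x * of_real ((1 + x) powr q)) \<le> B"
    unfolding bounded_iff by blast
  show ?thesis
  proof (rule that)
    fix x :: real assume x: "x \<ge> 0"
    have "norm (f x) * (1 + x) powr q \<le> max B (2 powr q)"
    proof (cases "x \<le> Y")
      case True
      thus ?thesis using B[of x] x by (simp add: norm_mult le_max_iff_disj)
    next
      case False
      hence "x \<ge> 1" "x \<ge> X" by (auto simp: Y_def)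
      \<comment> \<open>Here 1 + x <= 2x, which is the origin of the constant 2^q.\<close>
      have "norm (f x) * (1 + x) powr q \<le> x powr (- q) * (2 * x) powr q"
        using \<open>x \<ge> 1\<close> \<open>x \<ge> X\<close> assms(3) by (intro mult_mono X powr_mono2) auto
      also have "\<dots> = 2 powr q" using \<open>x \<ge> 1\<close> by (simp add: powr_mult powr_minus)
      finally show ?thesis by simp
    qed
    thus "norm (f x) \<le> max B (2 powr q) * (1 + x) powr (- q)"
      using x by (simp add: powr_minus field_simps)
  qed
qed

text \<open>The contiguous relation with u = b + is, v = b - is and third parameter b + c: its
  coefficients are those of the difference operator because (b+c) - u = c - is and v - u = -2is. For
  real nonzero s no denominator vanishes.\<close>

lemma index_integrand_times_x:
  fixes b c x s :: real and f :: "real \<Rightarrow> complex"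
  assumes "b > 0" "c > 0" "s \<noteq> 0" "x \<ge> 0"
  shows "index_integrand b c (\<lambda>x. of_real x * f x) (of_real s) x
    = difference_op b c (\<lambda>t. index_integrand b c f t x) (of_real s)"
proof -
  define u v where "u = of_real b + \<i> * of_real s" and "v = of_real b - \<i> * of_real s"
  have diffs: "- 2 * \<i> * of_real s + 1 = 1 - 2 * \<i> * of_real s" "2 * \<i> * of_real s + 1 = 1 + 2 * \<i> * of_real s"
    "v - u = - 2 * \<i> * of_real s" "u - v = 2 * \<i> * of_real s"
    "of_real (b + c) - u = of_real c - \<i> * of_real s" "of_real (b + c) - v = of_real c + \<i> * of_real s"
    by (simp_all add: u_def v_def)
  have shifts: "u - 1 = of_real b + \<i> * (of_real s + \<i>)" "v + 1 = of_real b - \<i> * (of_real s + \<i>)"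
    "u + 1 = of_real b + \<i> * (of_real s - \<i>)" "v - 1 = of_real b - \<i> * (of_real s - \<i>)"
    by (simp_all add: u_def v_def algebra_simps)
  have "of_real x * hyp2F1 u v (of_real (b + c)) (- of_real x) =
    v * (of_real (b + c) - u) / ((v - u) * (v - u + 1))
      * (hyp2F1 (u - 1) (v + 1) (of_real (b + c)) (- of_real x) - hyp2F1 u v (of_real (b + c)) (- of_real x)) +
    u * (of_real (b + c) - v) / ((u - v) * (u - v + 1))
      * (hyp2F1 (u + 1) (v - 1) (of_real (b + c)) (- of_real x) - hyp2F1 u v (of_real (b + c)) (- of_real x))"
    using hyp2F1_contiguous[of "b + c" u v "- of_real x"] assms
    by (simp add: u_def v_def complex_eq_iff)
  hence eq: "of_real x * hyp2F1 u v (of_real (b + c)) (- of_real x) =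
    difference_op b c (\<lambda>t. hyp2F1 (of_real b + \<i> * t) (of_real b - \<i> * t) (of_real (b + c)) (- of_real x)) (of_real s)"
    unfolding diffs shifts difference_op_def u_def[symmetric] v_def[symmetric] .
  have "index_integrand b c (\<lambda>x. of_real x * f x) (of_real s) x
    = f x * (of_real x * hyp2F1 u v (of_real (b + c)) (- of_real x))
      * of_real (x powr (b + c - 1)) * of_real ((1 + x) powr (b - c))"
    by (simp add: index_integrand_def u_def v_def mult_ac)
  also have "\<dots> = difference_op b c (\<lambda>t. index_integrand b c f t x) (of_real s)"
    unfolding eq difference_op_def index_integrand_def by (simp add: algebra_simps)
  finally show ?thesis .
qed

lemma difference_op_cmult: "difference_op b c (\<lambda>t. k * g t) s = k * difference_op b c g s"
proof -
  have "A * (k * x - k * y) + B * (k * z - k * y) = k * (A * (x - y) + B * (z - y))" for A B x y z :: complex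
    by (simp add: algebra_simps)
  thus ?thesis unfolding difference_op_def .
qed

theorem theorem2p1:
  fixes b c \<epsilon> :: real and f :: "real \<Rightarrow> complex"
  defines "g \<equiv> index_transform b c f"
    and "xf \<equiv> (\<lambda>x. of_real x * f x)"
  assumes "b > 0" and "c > 0" and "\<epsilon> > 0"
    and "continuous_on {0..} f"
    and "f \<in> o[at_top](\<lambda>x. of_real (x powr (- b - 1 - \<epsilon>)))"
  shows "(\<forall>s. \<bar>Im s\<bar> < 1 + \<epsilon> \<longrightarrow> set_integrable lborel {0..} (index_integrand b c f s))
    \<and> g holomorphic_on {s. \<bar>Im s\<bar> < 1 + \<epsilon>}
    \<and> (\<forall>s::real. set_integrable lborel {0..} (index_integrand b c xf (of_real s)))
    \<and> (\<forall>s::real. s \<noteq> 0 \<longrightarrow>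
          index_transform b c xf (of_real s) = difference_op b c g (of_real s))
    \<and> ((\<lambda>s::real. difference_op b c g (of_real s)) \<longlongrightarrow> index_transform b c xf 0) (at 0)"
proof -
  have "- (b + 1 + \<epsilon>) = - b - 1 - \<epsilon>" "b + 1 + \<epsilon> \<ge> 0" using assms by auto
  then obtain M where M: "\<And>x. x \<ge> 0 \<Longrightarrow> norm (f x) \<le> M * (1 + x) powr (- b - 1 - \<epsilon>)"
    using smallo_powr_imp_bound[of f "b + 1 + \<epsilon>"] assms by metis
  hence bnd: "norm (f x) \<le> M * (1 + x) powr (- b - (1 + \<epsilon>))" if "x \<ge> 0" for x
    using M[OF that] by (simp add: diff_diff_eq)
  \<comment> \<open>The factor x lowers \<kappa> from 1 + \<epsilon> to \<epsilon>, which still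
    leaves a strip around the real axis.\<close>
  have bnd_xf: "norm (xf x) \<le> M * (1 + x) powr (- b - \<epsilon>)" if x: "x \<ge> 0" for x
  proof -
    have "norm (xf x) = x * norm (f x)" using x by (simp add: xf_def norm_mult)
    also have "\<dots> \<le> (1 + x) * (M * (1 + x) powr (- b - 1 - \<epsilon>))"
      using x by (intro mult_mono M) auto
    also have "\<dots> = M * ((1 + x) powr 1 * (1 + x) powr (- b - 1 - \<epsilon>))" using x by simp
    also have "(1 + x) powr 1 * (1 + x) powr (- b - 1 - \<epsilon>) = (1 + x) powr (- b - \<epsilon>)"
      unfolding powr_add[symmetric] by simp
    finally show ?thesis .
  qed
  have cont_xf: "continuous_on {0..} xf"
    unfolding xf_def using assms by (intro continuous_intros)
  note int = index_integrand_integrable[OF \<open>b > 0\<close> \<open>c > 0\<close> \<open>continuous_on {0..} f\<close> bnd]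
  note int_xf = index_integrand_integrable[OF \<open>b > 0\<close> \<open>c > 0\<close> cont_xf bnd_xf]
  have diff: "index_transform b c xf (of_real s) = difference_op b c g (of_real s)" if s: "s \<noteq> 0" for s :: real
  proof -
    \<comment> \<open>The shifted points have |Im| = 1, strictly inside the strip of width parameter
      1 + \<epsilon>.\<close>
    have *: "set_integrable lborel {0..} (index_integrand b c f (of_real s + \<i>))"
      "set_integrable lborel {0..} (index_integrand b c f (of_real s - \<i>))"
      "set_integrable lborel {0..} (index_integrand b c f (of_real s))"
      using \<open>\<epsilon> > 0\<close> by (auto intro!: int)
    have "(LINT x:{0..}|lborel. index_integrand b c xf (of_real s) x)
        = (LINT x:{0..}|lborel. difference_op b c (\<lambda>t. index_integrand b c f t x) (of_real s))"
      unfolding xf_def using index_integrand_times_x[OF \<open>b > 0\<close> \<open>c > 0\<close> s]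
      by (intro set_lebesgue_integral_cong) auto
    \<comment> \<open>For fixed s the operator is a finite linear combination of three values, so it
      passes through the integral.\<close>
    also have "\<dots> = difference_op b c (\<lambda>t. LINT x:{0..}|lborel. index_integrand b c f t x) (of_real s)"
      unfolding difference_op_def
      by (simp only: set_integral_add set_integral_diff set_integral_mult_right set_integrable_mult_right *)
    finally show ?thesis
      unfolding g_def index_transform_def difference_op_cmult by simp
  qed
  \<comment> \<open>At s = 0 the quotients evaluate to 0 by the division convention, so only the
    punctured limit is meaningful. It follows from the identity for s different from 0 and the
    continuity of the transform of x f(x), holomorphic for |Im s| < \<epsilon>.\<close>
  have lim: "((\<lambda>s::real. difference_op b c g (of_real s)) \<longlongrightarrow> index_transform b c xf 0) (at 0)"
  proof (rule Lim_transform_eventually)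
    have "open {s. \<bar>Im s\<bar> < \<epsilon>}"
      by (intro open_Collect_less continuous_intros)
    hence "isCont (index_transform b c xf) (of_real 0)"
      using index_transform_holomorphic[OF \<open>b > 0\<close> \<open>c > 0\<close> cont_xf bnd_xf] \<open>\<epsilon> > 0\<close>
      by (intro continuous_on_interior[OF holomorphic_on_imp_continuous_on]) (auto simp: interior_open)
    hence "isCont (\<lambda>s. index_transform b c xf (of_real s)) (0 :: real)"
      by (rule isCont_o2[OF isCont_of_real[OF continuous_ident]])
    thus "((\<lambda>s. index_transform b c xf (of_real s)) \<longlongrightarrow> index_transform b c xf 0) (at (0 :: real))"
      by (simp add: isCont_def)
    show "eventually (\<lambda>s::real. index_transform b c xf (of_real s) = difference_op b c g (of_real s)) (at 0)"
      using diff by (auto simp: eventually_at_filter)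
  qed
  show ?thesis
    using int index_transform_holomorphic[OF \<open>b > 0\<close> \<open>c > 0\<close> \<open>continuous_on {0..} f\<close> bnd]
      int_xf diff lim \<open>\<epsilon> > 0\<close> unfolding g_def by simp
qed

end
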